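(* Let $f:\mathbb{R}^n\to\mathbb{R}$ be convex and three times differentiable with $\|D^3f(x)-D^3f(y)\|\le L_f\|x-y\|$ for all $x,y\in\mathbb{R}^n$, let $\psi:\mathbb{R}^n\to\mathbb{R}\cup\{+\infty\}$ be a simple convex function, and let $\tilde f=f+\psi$ have a minimizer $x^*$. Let $x_0\in\mathrm{dom}\,\psi$ and suppose that $\max\{\|x-x^*\| : \tilde f(x)\le\tilde f(x_0)\}\le R_0$ with $R_0\in(0,+\infty)$. Given $\epsilon>0$ (and $M_0>0$), assume that $\{x_t\}_{t=0}^{T}$ is generated by Algorithm 2 (described in the context) with $$\min\{\|\nabla\tilde f(x^+_{t,i})\|,\ \tilde f(x^+_{t,i})-\tilde f(x^* )\}\ge\epsilon,\qquad i=0,\dots,i_t\ \text{ and }\ t=0,\dots,T.$$ Denote by $m$ the first iteration number such that $$\tilde f(x_m)-\tilde f(x^* )\le 6^3\left(4\max\{2M_0,4L_f\}R_0^4\right),$$ and assume that $T>m$. Then $$m\le 1+\frac{1}{\log_2(4/3)}\log_2\log_2\left(\frac{\tilde f(x_0)-\tilde f(x^* )}{6^3\left(\max\{4M_0,8L_f\}R_0^4\right)}\right)$$ and, for all $k$ with $m\le k\le T$, $$\tilde f(x_k)-\tilde f(x^* )\le\frac{42^3\max\{4M_0,8L_f\}R_0^4}{(k-m)^3}.$$ Consequently, $$T\le m+42\max\{4M_0,8L_f\}^{1/3}R_0^{4/3}\epsilon^{-1/3}.$$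
   Context: $\|\cdot\|$ is the Euclidean norm on $\mathbb{R}^n$ and the induced norm on matrices and tensors. $\partial$ denotes the convex subdifferential; $\partial\tilde f(x)=\nabla f(x)+\partial\psi(x)$, and $\nabla\tilde f(x)$ denotes a chosen element of $\partial\tilde f(x)$. Models. $\Phi_x(y)=f(x)+\sum_{i=1}^3\frac1{i!}D^if(x)[y-x]^i$; for $M>0$, $\Omega_{x,M}(y)=\Phi_x(y)+\frac M8\|y-x\|^4$ and $\tilde\Omega_{x,M}=\Omega_{x,M}+\psi$. Also $\rho_x(y)=\frac12\langle\nabla^2f(x)(y-x),y-x\rangle+\frac M8\|y-x\|^4$ and $\beta_{\rho_x}(u,v)=\rho_x(v)-\rho_x(u)-\langle\nabla\rho_x(u),v-u\rangle$. Algorithm 1 (inner solver for approximately minimizing $\tilde\Omega_{x,M}$). Input: $x\in\mathrm{dom}\,\psi$, $\nabla\tilde f(x)\in\partial\tilde f(x)$, $M,\epsilon>0$. Step 0: set $L_{x,M}=\mathrm{trace}(\nabla^2f(x))+\frac{3M}2\left[\frac{96\|\nabla\tilde f(x)\|}{M}\right]^{2/3}$, $\beta_{x,M}=\frac12\mathrm{trace}(\nabla^2f(x))\left[\frac{96\|\nabla\tilde f(x)\|}{M}\right]^{2/3}+\frac M8\left[\frac{96\|\nabla\tilde f(x)\|}{M}\right]^{4/3}$, $y_0=x$, $\alpha=0$, $k=0$. Step 1: compute $y_{k+1}=\arg\min_{y\in\mathbb{R}^n}\{\langle\nabla\Omega_{x,M}(y_k),y-y_k\rangle+3\beta_{\rho_x}(y_k,y)+\psi(y)\}$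 and $g_\psi(y_{k+1})=-\nabla\Omega_{x,M}(y_k)+3[\nabla\rho_x(y_k)-\nabla\rho_x(y_{k+1})]$. Step 2: if $\|\nabla\Omega_{x,M}(y_{k+1})+g_\psi(y_{k+1})\|\le\epsilon/7$ or $\|\nabla\Omega_{x,M}(y_{k+1})+g_\psi(y_{k+1})\|\le\frac M6\|y_{k+1}-x\|^3$, set $x^+=y_{k+1}$ and stop. Step 3: if $\|\nabla\Omega_{x,M}(y_{k+1})+g_\psi(y_{k+1})\|^4>\frac{3^8L_{x,M}^4\beta_{x,M}}{2M(6/5)^k}$, set $x^+=y_{k+1}$, $\alpha=1$ and stop. Step 4: set $k:=k+1$ and go to Step 1. Output: $(x^+,\alpha)$, together with $g_\psi(x^+)$. Algorithm 2. Step 0: choose $x_0\in\mathrm{dom}\,\psi$, $M_0,\epsilon>0$; set $t=0$. Step 1: let $i$ be the smallest integer $\ge0$ with $2^iM_t\ge2M_0$. Step 1.1: apply Algorithm 1 with $x=x_t$, $M=2^iM_t$ and the same $\epsilon$; let $(x^+_{t,i},\alpha_{t,i})$ be its output and $\nabla\tilde f(x^+_{t,i})=\nabla f(x^+_{t,i})+g_\psi(x^+_{t,i})$. Step 1.2: if $\alpha_{t,i}=1$, set $i:=i+1$ and go to Step 1.1. Step 1.3: if $\|\nabla\tilde f(x^+_{t,i})\|\le\epsilon$, set $x_{t+1}=x^+_{t,i}$ and stop. Step 1.4: if $\tilde f(x_t)-\tilde f(x^+_{t,i})\ge\frac1{6(2^iM_t)^{1/3}}\|\nabla\tilde f(x^+_{t,i})\|^{4/3}$,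 set $i_t=i$ and go to Step 2; otherwise set $i:=i+1$ and go to Step 1.1. Step 2: set $x_{t+1}=x^+_{t,i_t}$, $M_{t+1}=2^{i_t-1}M_t$, $t:=t+1$, and go to Step 1.
   Formalization: The bound on m is proved in the form "m = 0 or m ≤ 1 + …": when m = 0 the iterated logarithm may be undefined or the right-hand side negative (e.g. inner argument 1.5), so the printed inequality can fail there; for m ≥ 1 it is as printed. *)

theory Defs
  imports "HOL-Analysis.Analysis"
begin

section \<open>Derivatives\<close>

text \<open>The Frechet derivative as a map into the normed space of bounded linear maps. Iterating it
  gives the higher derivatives as nested bounded linear maps; the norm of the nested map
  \<^term>\<open>D3 f x\<close> is the induced norm of the trilinear form, i.e. the supremum of
  \<open>\<bar>D3 f x h1 h2 h3\<bar>\<close> over unit vectors.\<close>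

definition Dblin :: "('a::real_normed_vector \<Rightarrow> 'b::real_normed_vector) \<Rightarrow> 'a \<Rightarrow> 'a \<Rightarrow>\<^sub>L 'b"
  where "Dblin f x = Blinfun (frechet_derivative f (at x))"

lemma Dblin_apply:
  assumes "f differentiable (at x)"
  shows "blinfun_apply (Dblin f x) = frechet_derivative f (at x)"
  using assms has_derivative_bounded_linear[of f "frechet_derivative f (at x)" "at x"]
  by (simp add: Dblin_def bounded_linear_Blinfun_apply frechet_derivative_works)

abbreviation "D1 f \<equiv> Dblin f"
abbreviation "D2 f \<equiv> Dblin (Dblin f)"
abbreviation "D3 f \<equiv> Dblin (Dblin (Dblin f))"

definition three_times_differentiable :: "('a::real_normed_vector \<Rightarrow> real) \<Rightarrow> bool"
  where "three_times_differentiable f \<longleftrightarrow>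
    (\<forall>x. f differentiable (at x) \<and> D1 f differentiable (at x) \<and> D2 f differentiable (at x))"

definition gradient :: "(real^'n \<Rightarrow> real) \<Rightarrow> real^'n \<Rightarrow> real^'n"
  where "gradient f x = (\<chi> i. frechet_derivative f (at x) (axis i 1))"

lemma GDERIV_gradient:
  fixes f :: "real^'n \<Rightarrow> real"
  assumes "f differentiable (at x)"
  shows "GDERIV f x :> gradient f x"
proof -
  let ?D = "frechet_derivative f (at x)"
  have d: "(f has_derivative ?D) (at x)"
    using assms by (simp add: frechet_derivative_works)
  then have lin: "linear ?D"
    by (rule has_derivative_linear)
  have "?D h = h \<bullet> gradient f x" for h
  proof -
    have "?D h = ?D (\<Sum>i\<in>UNIV. (h $ i) *\<^sub>R axis i 1)"
      using basis_expansion[of h] by (simp add: scalar_mult_eq_scaleR)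
    also have "\<dots> = (\<Sum>i\<in>UNIV. h $ i * ?D (axis i 1))"
      using lin by (simp add: linear_sum linear_scale)
    finally show ?thesis
      by (simp add: gradient_def inner_vec_def)
  qed
  then have "?D = (\<lambda>h. h \<bullet> gradient f x)" by blast
  with d show ?thesis by (simp add: gderiv_def)
qed

definition hessian :: "(real^'n \<Rightarrow> real) \<Rightarrow> real^'n \<Rightarrow> real^'n^'n"
  where "hessian f x = (\<chi> i j. D2 f x (axis i 1) (axis j 1))"

section \<open>Extended-valued convex functions\<close>

definition edom :: "('a \<Rightarrow> ereal) \<Rightarrow> 'a set"
  where "edom \<psi> = {x. \<psi> x < \<infinity>}"

text \<open>Convexity of a function with values in the reals extended by \<open>+\<infinity>\<close>.
  Note that \<open>0 * \<infinity> = 0\<close> in \<^typ>\<open>ereal\<close>, so the cases \<open>t = 0\<close> and \<open>t = 1\<close> are trivial.\<close>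

definition econvex :: "('a::real_vector \<Rightarrow> ereal) \<Rightarrow> bool"
  where "econvex \<psi> \<longleftrightarrow> (\<forall>x. \<psi> x \<noteq> -\<infinity>) \<and>
    (\<forall>x y. \<forall>t\<in>{0..1}. \<psi> ((1 - t) *\<^sub>R x + t *\<^sub>R y) \<le> ereal (1 - t) * \<psi> x + ereal t * \<psi> y)"

definition subdiff :: "('a::real_inner \<Rightarrow> ereal) \<Rightarrow> 'a \<Rightarrow> 'a set"
  where "subdiff \<psi> x = {g. x \<in> edom \<psi> \<and> (\<forall>y. \<psi> y \<ge> \<psi> x + ereal (g \<bullet> (y - x)))}"

definition composite :: "('a \<Rightarrow> real) \<Rightarrow> ('a \<Rightarrow> ereal) \<Rightarrow> 'a \<Rightarrow> ereal"
  where "composite f \<psi> x = ereal (f x) + \<psi> x"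

definition composite_subdiff :: "(real^'n \<Rightarrow> real) \<Rightarrow> (real^'n \<Rightarrow> ereal) \<Rightarrow> real^'n \<Rightarrow> (real^'n) set"
  where "composite_subdiff f \<psi> x = (\<lambda>g. gradient f x + g) ` subdiff \<psi> x"

section \<open>Models\<close>

definition Phi :: "(real^'n \<Rightarrow> real) \<Rightarrow> real^'n \<Rightarrow> real^'n \<Rightarrow> real"
  where "Phi f x y = f x + D1 f x (y - x) + 1/2 * D2 f x (y - x) (y - x)
    + 1/6 * D3 f x (y - x) (y - x) (y - x)"

definition Omega :: "(real^'n \<Rightarrow> real) \<Rightarrow> real^'n \<Rightarrow> real \<Rightarrow> real^'n \<Rightarrow> real"
  where "Omega f x M y = Phi f x y + M/8 * norm (y - x) ^ 4"

definition rho :: "(real^'n \<Rightarrow> real) \<Rightarrow> real^'n \<Rightarrow> real \<Rightarrow> real^'n \<Rightarrow> real"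
  where "rho f x M y = 1/2 * ((hessian f x *v (y - x)) \<bullet> (y - x)) + M/8 * norm (y - x) ^ 4"

definition bregman :: "(real^'n \<Rightarrow> real) \<Rightarrow> real^'n \<Rightarrow> real^'n \<Rightarrow> real"
  where "bregman r u v = r v - r u - gradient r u \<bullet> (v - u)"

section \<open>Algorithm 1: the inner solver\<close>

text \<open>The argument \<open>G\<close> is the element of the subdifferential of \<^term>\<open>composite f \<psi>\<close> at \<open>x\<close>
  that is given to the solver.\<close>

definition inner_L :: "(real^'n \<Rightarrow> real) \<Rightarrow> real^'n \<Rightarrow> real^'n \<Rightarrow> real \<Rightarrow> real"
  where "inner_L f x G M = trace (hessian f x) + 3 * M / 2 * (96 * norm G / M) powr (2/3)"

definition inner_beta :: "(real^'n \<Rightarrow> real) \<Rightarrow> real^'n \<Rightarrow> real^'n \<Rightarrow> real \<Rightarrow> real"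
  where "inner_beta f x G M = 1/2 * trace (hessian f x) * (96 * norm G / M) powr (2/3)
    + M/8 * (96 * norm G / M) powr (4/3)"

definition inner_step ::
    "(real^'n \<Rightarrow> real) \<Rightarrow> (real^'n \<Rightarrow> ereal) \<Rightarrow> real^'n \<Rightarrow> real \<Rightarrow> real^'n \<Rightarrow> real^'n \<Rightarrow> bool"
  where "inner_step f \<psi> x M y y' \<longleftrightarrow>
    is_arg_min
      (\<lambda>z. ereal (gradient (Omega f x M) y \<bullet> (z - y) + 3 * bregman (rho f x M) y z) + \<psi> z)
      (\<lambda>_. True) y'"

definition inner_g :: "(real^'n \<Rightarrow> real) \<Rightarrow> real^'n \<Rightarrow> real \<Rightarrow> real^'n \<Rightarrow> real^'n \<Rightarrow> real^'n"
  where "inner_g f x M y y' = - gradient (Omega f x M) y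
    + 3 *\<^sub>R (gradient (rho f x M) y - gradient (rho f x M) y')"

definition inner_res :: "(real^'n \<Rightarrow> real) \<Rightarrow> real^'n \<Rightarrow> real \<Rightarrow> real^'n \<Rightarrow> real^'n \<Rightarrow> real^'n"
  where "inner_res f x M y y' = gradient (Omega f x M) y' + inner_g f x M y y'"

definition inner_success ::
    "(real^'n \<Rightarrow> real) \<Rightarrow> real^'n \<Rightarrow> real \<Rightarrow> real \<Rightarrow> real^'n \<Rightarrow> real^'n \<Rightarrow> bool"
  where "inner_success f x M \<epsilon> y y' \<longleftrightarrow>
    norm (inner_res f x M y y') \<le> \<epsilon> / 7 \<or>
    norm (inner_res f x M y y') \<le> M/6 * norm (y' - x) ^ 3"

definition inner_failure ::
    "(real^'n \<Rightarrow> real) \<Rightarrow> real^'n \<Rightarrow> real^'n \<Rightarrow> real \<Rightarrow> nat \<Rightarrow> real^'n \<Rightarrow> real^'n \<Rightarrow> bool"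
  where "inner_failure f x G M k y y' \<longleftrightarrow>
    norm (inner_res f x M y y') ^ 4
      > 3 ^ 8 * inner_L f x G M ^ 4 * inner_beta f x G M / (2 * M * (6/5) ^ k)"

text \<open>The solver, started with \<open>x\<close>, \<open>G\<close>, \<open>M\<close>, \<open>\<epsilon>\<close>, stops in some iteration \<open>N\<close> and returns the
  point \<open>xp\<close>, the flag \<open>\<alpha>\<close> and the subgradient \<open>g\<close> of \<open>\<psi>\<close> at \<open>xp\<close>. The failure
  test is reached only if the success test was negative.\<close>

definition inner_solver ::
    "(real^'n \<Rightarrow> real) \<Rightarrow> (real^'n \<Rightarrow> ereal) \<Rightarrow> real^'n \<Rightarrow> real^'n \<Rightarrow> real \<Rightarrow> real
      \<Rightarrow> real^'n \<Rightarrow> nat \<Rightarrow> real^'n \<Rightarrow> bool"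
  where "inner_solver f \<psi> x G M \<epsilon> xp \<alpha> g \<longleftrightarrow>
    (\<exists>y N. y 0 = x \<and>
      (\<forall>k\<le>N. inner_step f \<psi> x M (y k) (y (Suc k))) \<and>
      (\<forall>k<N. \<not> inner_success f x M \<epsilon> (y k) (y (Suc k)) \<and>
             \<not> inner_failure f x G M k (y k) (y (Suc k))) \<and>
      (if inner_success f x M \<epsilon> (y N) (y (Suc N)) then \<alpha> = 0
       else inner_failure f x G M N (y N) (y (Suc N)) \<and> \<alpha> = 1) \<and>
      xp = y (Suc N) \<and> g = inner_g f x M (y N) (y (Suc N)))"

section \<open>Algorithm 2: the outer method\<close>

definition first_trial :: "real \<Rightarrow> real \<Rightarrow> nat"
  where "first_trial M0 M = (LEAST i. 2 ^ i * M \<ge> 2 * M0)"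

definition sufficient_decrease ::
    "(real^'n \<Rightarrow> real) \<Rightarrow> (real^'n \<Rightarrow> ereal) \<Rightarrow> real^'n \<Rightarrow> real \<Rightarrow> real^'n \<Rightarrow> real^'n \<Rightarrow> bool"
  where "sufficient_decrease f \<psi> x M xp Gp \<longleftrightarrow>
    composite f \<psi> x - composite f \<psi> xp \<ge> ereal (1 / (6 * M powr (1/3)) * norm Gp powr (4/3))"

text \<open>Iterations \<open>t = 0,\<dots>,T\<close> of the method, each ending with an accepted trial \<open>it t\<close>.
  \<open>xp t i\<close>, \<open>\<alpha> t i\<close> are the results of the inner solver in trial \<open>i\<close> of iteration \<open>t\<close>, and
  \<open>Gp t i\<close> is the resulting subgradient of the objective at \<open>xp t i\<close>; only the indices
  \<open>i\<close> from \<^term>\<open>first_trial M0 (M t)\<close> to \<open>it t\<close> occur. \<open>G t\<close> is the subgradient of the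
  objective at \<open>x t\<close> passed to the inner solver: arbitrary at the starting point,
  afterwards the one computed together with \<open>x t\<close>.\<close>

definition outer_run ::
    "(real^'n \<Rightarrow> real) \<Rightarrow> (real^'n \<Rightarrow> ereal) \<Rightarrow> real^'n \<Rightarrow> real \<Rightarrow> real \<Rightarrow> nat
      \<Rightarrow> (nat \<Rightarrow> real^'n) \<Rightarrow> (nat \<Rightarrow> real^'n) \<Rightarrow> (nat \<Rightarrow> real) \<Rightarrow> (nat \<Rightarrow> nat)
      \<Rightarrow> (nat \<Rightarrow> nat \<Rightarrow> real^'n) \<Rightarrow> (nat \<Rightarrow> nat \<Rightarrow> nat) \<Rightarrow> (nat \<Rightarrow> nat \<Rightarrow> real^'n) \<Rightarrow> bool"
  where "outer_run f \<psi> x0 M0 \<epsilon> T x G M it xp \<alpha> Gp \<longleftrightarrow>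
    x 0 = x0 \<and> M 0 = M0 \<and> G 0 \<in> composite_subdiff f \<psi> x0 \<and>
    (\<forall>t\<le>T.
      first_trial M0 (M t) \<le> it t \<and>
      (\<forall>i\<in>{first_trial M0 (M t)..it t}.
        \<exists>g. inner_solver f \<psi> (x t) (G t) (2 ^ i * M t) \<epsilon> (xp t i) (\<alpha> t i) g \<and>
            Gp t i = gradient f (xp t i) + g) \<and>
      (\<forall>i\<in>{first_trial M0 (M t)..<it t}.
        \<alpha> t i = 1 \<or>
        (norm (Gp t i) > \<epsilon> \<and>
         \<not> sufficient_decrease f \<psi> (x t) (2 ^ i * M t) (xp t i) (Gp t i))) \<and>
      \<alpha> t (it t) = 0 \<and> norm (Gp t (it t)) > \<epsilon> \<and>
      sufficient_decrease f \<psi> (x t) (2 ^ it t * M t) (xp t (it t)) (Gp t (it t)) \<and>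
      x (Suc t) = xp t (it t) \<and> G (Suc t) = Gp t (it t) \<and>
      M (Suc t) = 2 powi (int (it t) - 1) * M t)"

end

(* Convexity at the points x +- 2h gives
   |D^3 f(x)[h,d,d]| <= (1/2) D^2 f(x)[d,d] + L |h|^2 |d|^2, so for M >= 4 L the quartic model is
   3/2-smooth and 1/2-strongly convex relative to rho. Hence the Bregman gradient steps with
   constant 3 contract the Bregman distance by 5/6, the failure test of the inner solver is never
   met, and the residual bound at its output, squared, yields the sufficient decrease. So every
   trial with 2^i M_t >= 4 L is accepted, and the accepted values stay below
   H = max (4 M_0) (8 L). Combined with f~(x_{t+1}) - f~* <= |G_{t+1}| R_0, the normalized gaps
   u_t = (f~(x_t) - f~* ) / (6^3 H R_0^4) satisfy u_{t+1}^{4/3} <= u_t - u_{t+1}, which forces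
   log u_t to shrink by the factor 3/4 while u_t > 2, and u_t^{-1/3} to grow by at least 1/7 per
   step afterwards. *)

theory Submission
  imports Defs
begin

section \<open>Symmetry of second derivatives\<close>

text \<open>The scale 2 in x +- 2h fixes the constants. A scale tau would bound the cubic term by
  D^2/tau + (tau/2) L |h|^2 |d|^2; tau = 2 leaves half of the Hessian, and M >= 4 L makes the other
  term at most half of the quartic part of the Hessian of rho. A step constant 3 against the
  relative bounds 1/2 and 3/2 then compares 3 - 1/2 with 3, whence the factor 5/6. Small M is the
  obstacle: the model may then be nonconvex, yet such trials can be accepted. Subgradient facts
  about the output are therefore kept valid for every M > 0, and only the acceptance argument uses M
  >= 4 L. The recursion for u_t is implicit because the subgradient at the new point controls both
  the decrease and the new gap. For large u, dropping the subtracted term leaves a power law; for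
  small u the same inequality is a discrete form of u' = -u^(4/3), with cubic decay. The scale 6^3 H
  R_0^4 absorbs the factor 1/(6 H^(1/3)) and the radius, and 42 = 6 * 7 joins it with the increment
  1/7.\<close>

lemma second_difference_estimate:
  fixes F :: "'a::real_normed_vector \<Rightarrow> real" and F' :: "'a \<Rightarrow> 'a \<Rightarrow>\<^sub>L real"
    and F'' :: "'a \<Rightarrow> 'a \<Rightarrow>\<^sub>L real"
  assumes F: "\<And>y. (F has_derivative blinfun_apply (F' y)) (at y)"
    and lin: "linear F''"
    and est: "\<And>v. norm v \<le> s * (norm a + norm b) \<Longrightarrow> norm (F' (x + v) - F' x - F'' v) \<le> e * norm v"
    and s: "s > 0" and e: "e \<ge> 0"
  shows "\<bar>F (x + s *\<^sub>R a + s *\<^sub>R b) - F (x + s *\<^sub>R a) - F (x + s *\<^sub>R b) + F x - s\<^sup>2 * F'' b a\<bar>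
    \<le> s\<^sup>2 * (2 * e * (norm a + norm b) * norm a)"
proof -
  let ?p = "\<lambda>r. F (x + r *\<^sub>R a + s *\<^sub>R b) - F (x + r *\<^sub>R a)"
  have d: "(?p has_real_derivative (F' (x + r *\<^sub>R a + s *\<^sub>R b) a - F' (x + r *\<^sub>R a) a)) (at r)" for r
    unfolding has_field_derivative_def
    by (rule has_derivative_eq_rhs, rule has_derivative_diff;
        (rule has_derivative_compose[OF _ F, unfolded o_def])?)
       (auto intro!: derivative_eq_intros simp: blinfun.bilinear_simps fun_eq_iff algebra_simps)
  \<comment> \<open>The mean value theorem acts along \<open>a\<close> on the difference of
    \<open>F\<close> across the shift \<open>s b\<close>. Both values of \<open>F'\<close> are then
    linearized at the single point \<open>x\<close>, and the \<open>F''\<close> terms in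
    \<open>z a\<close> cancel.\<close>
  obtain z where z: "0 < z" "z < s"
    and eq: "?p s - ?p 0 = (s - 0) * (F' (x + z *\<^sub>R a + s *\<^sub>R b) a - F' (x + z *\<^sub>R a) a)"
    using MVT2[OF s d] by blast
  let ?v = "z *\<^sub>R a + s *\<^sub>R b" and ?w = "z *\<^sub>R a"
  let ?E1 = "F' (x + ?v) - F' x - F'' ?v" and ?E2 = "F' (x + ?w) - F' x - F'' ?w"
  have za: "z * norm a \<le> s * norm a" using z by (intro mult_right_mono) auto
  have nv: "norm ?v \<le> s * (norm a + norm b)"
    using norm_triangle_ineq[of "z *\<^sub>R a" "s *\<^sub>R b"] za z by (simp add: algebra_simps)
  have nw: "norm ?w \<le> s * (norm a + norm b)"
    using za z s by (simp add: algebra_simps add_increasing2)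
  have n1: "norm ?E1 \<le> e * (s * (norm a + norm b))"
    using est[OF nv] mult_left_mono[OF nv e] by linarith
  have n2: "norm ?E2 \<le> e * (s * (norm a + norm b))"
    using est[OF nw] mult_left_mono[OF nw e] by linarith
  have "norm (?E1 - ?E2) \<le> 2 * e * s * (norm a + norm b)"
    using norm_triangle_ineq4[of ?E1 ?E2] n1 n2 by (simp add: algebra_simps)
  then have A: "\<bar>blinfun_apply (?E1 - ?E2) a\<bar> \<le> 2 * e * s * (norm a + norm b) * norm a"
    using norm_blinfun[of "?E1 - ?E2" a] by (smt (verit) mult_right_mono norm_ge_zero real_norm_def)
  have "blinfun_apply (?E1 - ?E2) a = F' (x + z *\<^sub>R a + s *\<^sub>R b) a - F' (x + z *\<^sub>R a) a - s * F'' b a"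
    using lin by (simp add: linear_add linear_scale blinfun.bilinear_simps algebra_simps)
  then have "?p s - ?p 0 - s\<^sup>2 * F'' b a = s * blinfun_apply (?E1 - ?E2) a"
    unfolding eq by (simp only: power2_eq_square) (simp add: right_diff_distrib)
  then have "\<bar>?p s - ?p 0 - s\<^sup>2 * F'' b a\<bar> \<le> s * (2 * e * s * (norm a + norm b) * norm a)"
    using A s by (simp add: abs_mult)
  then show ?thesis by (simp add: power2_eq_square algebra_simps)
qed

text \<open>The second difference over the parallelogram with sides \<open>s a\<close> and
  \<open>s b\<close> does not change when the sides are swapped, so it approximates both
  \<open>F'' b a\<close> and \<open>F'' a b\<close> up to an arbitrarily small multiple of
  \<open>s\<^sup>2\<close>.\<close>

lemma second_derivative_symmetric:
  fixes F :: "'a::real_normed_vector \<Rightarrow> real" and F' :: "'a \<Rightarrow> 'a \<Rightarrow>\<^sub>L real"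
    and F'' :: "'a \<Rightarrow> 'a \<Rightarrow>\<^sub>L real"
  assumes F: "\<And>y. (F has_derivative blinfun_apply (F' y)) (at y)"
    and F': "(F' has_derivative F'') (at x)"
  shows "F'' a b = F'' b a"
proof (rule ccontr)
  assume ne: "F'' a b \<noteq> F'' b a"
  define N where "N = norm a + norm b"
  \<comment> \<open>The summand 1 makes \<open>2 * e * K\<close>, which equals the asymmetry,
    strictly larger than the bound \<open>2 * e * N\<^sup>2\<close> derived below.\<close>
  define K where "K = 2 * N\<^sup>2 + 1"
  have K: "K > 0" by (simp add: K_def add_nonneg_pos)
  define e where "e = \<bar>F'' a b - F'' b a\<bar> / (2 * K)"
  have e: "e > 0" using ne K by (simp add: e_def)
  have lin: "linear F''" using F' by (rule has_derivative_linear)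
  obtain d where d: "d > 0"
    and dd: "\<And>y. norm (y - x) < d \<Longrightarrow> norm (F' y - F' x - F'' (y - x)) \<le> e * norm (y - x)"
    using F' e unfolding has_derivative_at_alt by blast
  define s where "s = d / (N + 1) / 2"
  have N: "N \<ge> 0" by (simp add: N_def)
  have s: "s > 0" using d N by (simp add: s_def)
  have "s * N < d"
  proof -
    have "d * N < d * (2 * (N + 1))" using d N by (intro mult_strict_left_mono) auto
    then show ?thesis using N by (simp add: s_def field_simps)
  qed
  then have est: "norm (F' (x + v) - F' x - F'' v) \<le> e * norm v" if "norm v \<le> s * N" for v
    using dd[of "x + v"] that by simp
  have 1: "\<bar>F (x + s *\<^sub>R a + s *\<^sub>R b) - F (x + s *\<^sub>R a) - F (x + s *\<^sub>R b) + F x - s\<^sup>2 * F'' b a\<bar>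
    \<le> s\<^sup>2 * (2 * e * N * norm a)"
    unfolding N_def
    by (rule second_difference_estimate[OF F lin _ s]) (use est e in \<open>auto simp: N_def\<close>)
  have 2: "\<bar>F (x + s *\<^sub>R b + s *\<^sub>R a) - F (x + s *\<^sub>R b) - F (x + s *\<^sub>R a) + F x - s\<^sup>2 * F'' a b\<bar>
    \<le> s\<^sup>2 * (2 * e * (norm b + norm a) * norm b)"
    by (rule second_difference_estimate[OF F lin _ s]) (use est e in \<open>auto simp: N_def add.commute\<close>)
  have "\<bar>s\<^sup>2 * F'' a b - s\<^sup>2 * F'' b a\<bar> \<le> s\<^sup>2 * (2 * e * N * norm a) + s\<^sup>2 * (2 * e * N * norm b)"
    using 1 2 by (simp add: N_def add_ac)
  also have "\<dots> = s\<^sup>2 * (2 * e * N\<^sup>2)" by (simp add: N_def power2_eq_square algebra_simps)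
  finally have "s\<^sup>2 * \<bar>F'' a b - F'' b a\<bar> \<le> s\<^sup>2 * (2 * e * N\<^sup>2)"
    by (simp add: right_diff_distrib[symmetric] abs_mult)
  then have le: "\<bar>F'' a b - F'' b a\<bar> \<le> 2 * e * N\<^sup>2" using s by simp
  have "2 * e * K = \<bar>F'' a b - F'' b a\<bar>"
    using K by (simp add: e_def)
  then show False using le e zero_le_power2[of N] mult_nonneg_nonneg[of e "N\<^sup>2"] e
    by (simp add: K_def algebra_simps)
qed

lemma Dblin_has_derivative:
  assumes "f differentiable (at x)"
  shows "(f has_derivative blinfun_apply (Dblin f x)) (at x)"
  using assms by (simp add: Dblin_apply frechet_derivative_works)

lemma gradient_eqI:
  assumes "(F has_derivative F') (at x)"
  shows "gradient F x \<bullet> e = F' e"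
proof -
  have "F differentiable (at x)" using assms by (auto simp: differentiable_def)
  from GDERIV_gradient[OF this] have "(F has_derivative (\<lambda>h. h \<bullet> gradient F x)) (at x)"
    by (simp add: gderiv_def)
  then have "(\<lambda>h. h \<bullet> gradient F x) = F'" using assms has_derivative_unique by blast
  then show ?thesis by (metis inner_commute)
qed

section \<open>Convex functions with Lipschitz third derivative\<close>

text \<open>Degenerate forms are included, because the Hessians to which this is applied are only
  semidefinite; the discriminant argument therefore splits on \<open>B b b = 0\<close>.\<close>

lemma symmetric_psd_Cauchy_Schwarz:
  fixes B :: "'a::real_vector \<Rightarrow> 'a \<Rightarrow> real"
  assumes lin1: "\<And>b. linear (\<lambda>a. B a b)" and lin2: "\<And>a. linear (B a)"
    and sym: "\<And>a b. B a b = B b a" and pos: "\<And>a. B a a \<ge> 0"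
  shows "(B a b)\<^sup>2 \<le> B a a * B b b"
proof -
  have *: "0 \<le> B a a - 2 * t * B a b + t\<^sup>2 * B b b" for t
  proof -
    have "B (a - t *\<^sub>R b) (a - t *\<^sub>R b) = B a a - 2 * t * B a b + t\<^sup>2 * B b b"
      by (simp add: linear_diff[OF lin1] linear_diff[OF lin2] linear_scale[OF lin1]
          linear_scale[OF lin2] sym[of b a] power2_eq_square algebra_simps)
    then show ?thesis using pos[of "a - t *\<^sub>R b"] by simp
  qed
  show ?thesis
  proof (cases "B b b = 0")
    case True
    have "B a b = 0"
    proof (rule ccontr)
      assume "B a b \<noteq> 0"
      \<comment> \<open>With \<open>B b b = 0\<close> the inequality is affine in \<open>t\<close>,
        and this \<open>t\<close> turns it into 0 \<le> -1.\<close>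
      then show False using *[of "(B a a + 1) / (2 * B a b)"] True by simp
    qed
    then show ?thesis using True by simp
  next
    case False
    with pos[of b] have b: "B b b > 0" by linarith
    have "0 \<le> (B a a - 2 * (B a b / B b b) * B a b + (B a b / B b b)\<^sup>2 * B b b) * B b b"
      using *[of "B a b / B b b"] b by (intro mult_nonneg_nonneg) auto
    also have "\<dots> = B a a * B b b - (B a b)\<^sup>2"
      using b by (simp add: power2_eq_square field_simps)
    finally show ?thesis by simp
  qed
qed

text \<open>Stands in for integrating a remainder bound once: the comparison power minus
  \<open>p\<close> and plus \<open>p\<close> are both nondecreasing for nonnegative
  arguments.\<close>

lemma abs_le_power_if_deriv_le_power:
  fixes p p' :: "real \<Rightarrow> real"
  assumes "\<And>t. (p has_real_derivative p' t) (at t)" and "p 0 = 0"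
    and "\<And>t. t \<ge> 0 \<Longrightarrow> \<bar>p' t\<bar> \<le> C * t ^ n" and "s \<ge> 0"
  shows "\<bar>p s\<bar> \<le> C / (n + 1) * s ^ (n + 1)"
proof -
  have d: "((\<lambda>t. C / (n + 1) * t ^ (n + 1)) has_real_derivative C * t ^ n) (at t)" for t
    using DERIV_cmult[OF DERIV_pow[of "n + 1" t], of "C / (n + 1)"] by simp
  have "C / (n + 1) * 0 ^ (n + 1) - p 0 \<le> C / (n + 1) * s ^ (n + 1) - p s"
  proof (rule DERIV_nonneg_imp_nondecreasing[OF \<open>s \<ge> 0\<close>])
    fix t :: real assume "0 \<le> t"
    with assms(3)[of t] DERIV_diff[OF d assms(1), of t]
    show "\<exists>y. ((\<lambda>t. C / (n + 1) * t ^ (n + 1) - p t) has_real_derivative y) (at t) \<and> 0 \<le> y"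
      by (intro exI[of _ "C * t ^ n - p' t"]) auto
  qed
  moreover have "C / (n + 1) * 0 ^ (n + 1) + p 0 \<le> C / (n + 1) * s ^ (n + 1) + p s"
  proof (rule DERIV_nonneg_imp_nondecreasing[OF \<open>s \<ge> 0\<close>])
    fix t :: real assume "0 \<le> t"
    with assms(3)[of t] DERIV_add[OF d assms(1), of t]
    show "\<exists>y. ((\<lambda>t. C / (n + 1) * t ^ (n + 1) + p t) has_real_derivative y) (at t) \<and> 0 \<le> y"
      by (intro exI[of _ "C * t ^ n + p' t"]) auto
  qed
  ultimately show ?thesis using \<open>p 0 = 0\<close> by simp
qed

lemma has_real_derivative_along_line:
  fixes F :: "'a::real_normed_vector \<Rightarrow> real"
  assumes "(F has_derivative F') (at (x + t *\<^sub>R h))"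
  shows "((\<lambda>t. F (x + t *\<^sub>R h)) has_real_derivative F' h) (at t)"
proof -
  have "((\<lambda>t. x + t *\<^sub>R h) has_derivative (\<lambda>t. t *\<^sub>R h)) (at t)"
    by (auto intro!: derivative_eq_intros)
  from has_derivative_compose[OF this assms]
  have "((\<lambda>t. F (x + t *\<^sub>R h)) has_derivative (\<lambda>t. F' (t *\<^sub>R h))) (at t)" .
  moreover have "(\<lambda>t. F' (t *\<^sub>R h)) = (*) (F' h)"
    using has_derivative_linear[OF assms] by (simp add: fun_eq_iff linear_scale)
  ultimately show ?thesis by (simp add: has_field_derivative_def)
qed

locale smooth_convex =
  fixes f :: "real^'n \<Rightarrow> real" and L :: real
  assumes convex: "convex_on UNIV f"
    and differentiable3: "three_times_differentiable f"
    and lipschitz_D3: "norm (D3 f y - D3 f z) \<le> L * norm (y - z)"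
begin

lemma L_nonneg: "L \<ge> 0"
proof -
  have "0 \<le> L * norm (axis undefined 1 - 0 :: real^'n)"
    using lipschitz_D3[of "axis undefined 1" 0] norm_ge_zero order_trans by blast
  then show ?thesis by simp
qed

lemma D1: "(f has_derivative D1 f y) (at y)"
  and D2: "(D1 f has_derivative D2 f y) (at y)"
  and D3: "(D2 f has_derivative D3 f y) (at y)"
  using differentiable3 by (auto simp: three_times_differentiable_def intro: Dblin_has_derivative)

lemma D1_apply: "((\<lambda>y. D1 f y a) has_derivative (\<lambda>h. D2 f y h a)) (at y)"
  by (rule bounded_linear.has_derivative[OF blinfun.bounded_linear_left D2])

lemma D2_apply: "((\<lambda>y. D2 f y a b) has_derivative (\<lambda>h. D3 f y h a b)) (at y)"
proof -
  have "((\<lambda>y. D2 f y a) has_derivative (\<lambda>h. D3 f y h a)) (at y)"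
    by (rule bounded_linear.has_derivative[OF blinfun.bounded_linear_left D3])
  then show ?thesis
    by (rule bounded_linear.has_derivative[OF blinfun.bounded_linear_left])
qed

lemma D2_symmetric: "D2 f x a b = D2 f x b a"
  using second_derivative_symmetric[OF D1 D2] .

lemma D3_symmetric1: "D3 f x a b c = D3 f x b a c"
proof -
  \<comment> \<open>Evaluation at \<open>c\<close> as a bounded linear map, so that the derivative
    of \<open>D1 f y c\<close> in \<open>y\<close> is itself a differentiable map into bounded
    linear maps and the symmetry of second derivatives applies.\<close>
  define E where "E = Blinfun (\<lambda>A :: (real^'n) \<Rightarrow>\<^sub>L real. A c)"
  have E: "E A = A c" for A
    by (simp add: E_def bounded_linear_Blinfun_apply blinfun.bounded_linear_left)
  have "((\<lambda>y. D1 f y c) has_derivative (E o\<^sub>L D2 f y)) (at y)" for y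
    by (rule has_derivative_eq_rhs[OF D1_apply]) (simp add: E fun_eq_iff)
  moreover have "((\<lambda>y. E o\<^sub>L D2 f y) has_derivative (\<lambda>h. E o\<^sub>L D3 f x h)) (at x)"
    by (rule bounded_linear.has_derivative[OF _ D3])
      (rule bounded_bilinear.bounded_linear_right[OF bounded_bilinear_blinfun_compose])
  ultimately show ?thesis
    using second_derivative_symmetric[of "\<lambda>y. D1 f y c" "\<lambda>y. E o\<^sub>L D2 f y" "\<lambda>h. E o\<^sub>L D3 f x h" x a b]
    by (simp add: E)
qed

text \<open>Uniqueness of derivatives transfers the symmetry of \<open>D2 f\<close> to the last two
  slots; with the swap of the first two, all permutations are available.\<close>

lemma D3_symmetric2: "D3 f x a b c = D3 f x a c b"
proof -
  have "(\<lambda>h. D3 f x h b c) = (\<lambda>h. D3 f x h c b)"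
    using D2_apply[of b c x] D2_apply[of c b x] has_derivative_unique
    by (simp add: D2_symmetric[of _ b c])
  then show ?thesis by metis
qed

lemma tangent_le: "f y + D1 f y (z - y) \<le> f z"
proof -
  have "convex_on UNIV (\<lambda>t. f (y + t *\<^sub>R (z - y)))"
  proof (rule convex_onI)
    fix t r s :: real assume t: "0 < t" "t < 1"
    have "y + ((1 - t) * r + t * s) *\<^sub>R (z - y)
        = (1 - t) *\<^sub>R (y + r *\<^sub>R (z - y)) + t *\<^sub>R (y + s *\<^sub>R (z - y))"
      by (simp add: algebra_simps)
    then show "f (y + ((1 - t) *\<^sub>R r + t *\<^sub>R s) *\<^sub>R (z - y))
        \<le> (1 - t) * f (y + r *\<^sub>R (z - y)) + t * f (y + s *\<^sub>R (z - y))"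
      using convex_onD[OF convex, of t] t by simp
  qed simp
  moreover have "((\<lambda>t. f (y + t *\<^sub>R (z - y))) has_real_derivative D1 f y (z - y)) (at 0)"
    by (rule has_real_derivative_along_line) (simp add: D1)
  ultimately have "D1 f y (z - y) * (1 - 0) \<le> f (y + 1 *\<^sub>R (z - y)) - f (y + 0 *\<^sub>R (z - y))"
    by (intro convex_on_imp_above_tangent[where A = UNIV]) auto
  then show ?thesis by simp
qed

text \<open>A negative value would make the slope along \<open>d\<close> drop just after
  \<open>y\<close>, whereas adding the tangent inequalities at two points of the line shows that the
  slope is monotone.\<close>

lemma D2_nonneg: "D2 f y d d \<ge> 0"
proof (rule ccontr)
  assume "\<not> D2 f y d d \<ge> 0"
  moreover have "((\<lambda>t. D1 f (y + t *\<^sub>R d) d) has_real_derivative D2 f y d d) (at 0)"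
    by (rule has_real_derivative_along_line[where F = "\<lambda>y. D1 f y d"]) (simp add: D1_apply)
  ultimately obtain e where e: "e > 0"
    and dec: "\<And>h. h > 0 \<Longrightarrow> h < e \<Longrightarrow> D1 f (y + h *\<^sub>R d) d < D1 f y d"
    using DERIV_neg_dec_right[of "\<lambda>t. D1 f (y + t *\<^sub>R d) d" "D2 f y d d" 0] by auto
  define h where "h = e / 2"
  have h: "h > 0" "h < e" using e by (auto simp: h_def)
  have "f y + h * D1 f y d \<le> f (y + h *\<^sub>R d)" "f (y + h *\<^sub>R d) - h * D1 f (y + h *\<^sub>R d) d \<le> f y"
    using tangent_le[of y "y + h *\<^sub>R d"] tangent_le[of "y + h *\<^sub>R d" y]
    by (simp_all add: blinfun.bilinear_simps)
  then have "h * D1 f y d \<le> h * D1 f (y + h *\<^sub>R d) d" by linarith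
  then show False using dec[OF h] h by simp
qed

lemma D2_taylor: "\<bar>D2 f (x + h) a b - D2 f x a b - D3 f x h a b\<bar> \<le> L / 2 * norm h ^ 2 * norm a * norm b"
proof -
  let ?p = "\<lambda>t. D2 f (x + t *\<^sub>R h) a b - D2 f x a b - t * D3 f x h a b"
  let ?C = "L * norm h ^ 2 * norm a * norm b"
  have "\<bar>?p 1\<bar> \<le> ?C / real (1 + 1) * 1 ^ (1 + 1)"
  proof (rule abs_le_power_if_deriv_le_power)
    show "(?p has_real_derivative (D3 f (x + t *\<^sub>R h) h a b - D3 f x h a b)) (at t)" for t
      using has_real_derivative_along_line[OF D2_apply, where x = x and h = h]
      by (auto intro!: derivative_eq_intros)
    show "\<bar>D3 f (x + t *\<^sub>R h) h a b - D3 f x h a b\<bar> \<le> ?C * t ^ 1" if "t \<ge> 0" for t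
    proof -
      let ?A = "D3 f (x + t *\<^sub>R h) - D3 f x"
      have "\<bar>?A h a b\<bar> \<le> norm (?A h a) * norm b"
        using norm_blinfun[of "?A h a" b] by simp
      also have "\<dots> \<le> norm (?A h) * norm a * norm b"
        by (intro mult_right_mono norm_blinfun) auto
      also have "\<dots> \<le> norm ?A * norm h * norm a * norm b"
        by (intro mult_right_mono norm_blinfun) auto
      also have "\<dots> \<le> (L * norm (x + t *\<^sub>R h - x)) * norm h * norm a * norm b"
        by (intro mult_right_mono lipschitz_D3) auto
      finally show ?thesis
        using that by (simp add: blinfun.bilinear_simps power2_eq_square mult_ac)
    qed
  qed auto
  then show ?thesis by simp
qed

text \<open>Integrates \<open>D2_taylor\<close> along the segment from \<open>x\<close> to
  \<open>x + h\<close>, which divides L/2 by 3.\<close>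

lemma D1_taylor:
  "\<bar>D1 f (x + h) a - D1 f x a - D2 f x h a - 1/2 * D3 f x h h a\<bar> \<le> L / 6 * norm h ^ 3 * norm a"
proof -
  let ?p = "\<lambda>t. D1 f (x + t *\<^sub>R h) a - D1 f x a - t * D2 f x h a - t\<^sup>2 / 2 * D3 f x h h a"
  let ?C = "L / 2 * norm h ^ 3 * norm a"
  have "\<bar>?p 1\<bar> \<le> ?C / real (2 + 1) * 1 ^ (2 + 1)"
  proof (rule abs_le_power_if_deriv_le_power)
    show "(?p has_real_derivative (D2 f (x + t *\<^sub>R h) h a - D2 f x h a - t * D3 f x h h a)) (at t)" for t
      using has_real_derivative_along_line[OF D1_apply, where x = x and h = h]
      by (auto intro!: derivative_eq_intros)
    show "\<bar>D2 f (x + t *\<^sub>R h) h a - D2 f x h a - t * D3 f x h h a\<bar> \<le> ?C * t\<^sup>2" if "t \<ge> 0" for t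
      using D2_taylor[of x "t *\<^sub>R h" h a] that
      by (simp add: blinfun.bilinear_simps power2_eq_square power3_eq_cube mult_ac)
  qed auto
  then show ?thesis by simp
qed

text \<open>Convexity of \<open>f\<close> at the two points \<open>x \<plusminus> 2 h\<close> controls the sign-indefinite cubic term by
  the Hessian.\<close>

lemma D3_le_D2: "\<bar>D3 f x h d d\<bar> \<le> 1/2 * D2 f x d d + L * norm h ^ 2 * norm d ^ 2"
proof -
  have "- 2 * D3 f x h d d \<le> D2 f x d d + 2 * L * norm h ^ 2 * norm d ^ 2"
    using D2_taylor[of x "2 *\<^sub>R h" d d] D2_nonneg[of "x + 2 *\<^sub>R h" d]
    by (simp add: blinfun.bilinear_simps power2_eq_square mult_ac)
  moreover have "2 * D3 f x h d d \<le> D2 f x d d + 2 * L * norm h ^ 2 * norm d ^ 2"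
    using D2_taylor[of x "(-2) *\<^sub>R h" d d] D2_nonneg[of "x + (-2) *\<^sub>R h" d]
    by (simp add: blinfun.bilinear_simps power2_eq_square mult_ac)
  ultimately show ?thesis by linarith
qed

end

section \<open>The quartic model\<close>

lemma norm_power4_eq: "norm (h::'a::real_inner) ^ 4 = (h \<bullet> h)\<^sup>2"
  by (simp add: power2_norm_eq_inner[symmetric])

text \<open>Used with \<Omega> - 1/2 \<rho> and 3/2 \<rho> - \<Omega>, where it turns a pointwise
  comparison of Hessians into inequalities with Bregman distances.\<close>

lemma convex_if_second_derivative_nonneg:
  fixes F :: "'a::real_normed_vector \<Rightarrow> real"
  assumes F: "\<And>y. (F has_derivative F' y) (at y)"
    and F': "\<And>y d. ((\<lambda>y. F' y d) has_derivative (\<lambda>h. F'' y h d)) (at y)"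
    and pos: "\<And>y d. F'' y d d \<ge> 0"
  shows "F u + F' u (v - u) \<le> F v"
proof -
  define d where "d = v - u"
  have 1: "((\<lambda>t. F (u + t *\<^sub>R d) - t * F' u d) has_real_derivative F' (u + t *\<^sub>R d) d - F' u d) (at t)" for t
    using has_real_derivative_along_line[OF F, where x = u and h = d]
    by (auto intro!: derivative_eq_intros)
  have 2: "F' u d \<le> F' (u + t *\<^sub>R d) d" if "t \<ge> 0" for t
  proof -
    have "((\<lambda>t. F' (u + t *\<^sub>R d) d) has_real_derivative F'' (u + t *\<^sub>R d) d d) (at t)" for t
      by (rule has_real_derivative_along_line[OF F'])
    then have "F' (u + 0 *\<^sub>R d) d \<le> F' (u + t *\<^sub>R d) d"
      using pos by (intro DERIV_nonneg_imp_nondecreasing[OF that]) blast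
    then show ?thesis by simp
  qed
  have "F (u + 0 *\<^sub>R d) - 0 * F' u d \<le> F (u + 1 *\<^sub>R d) - 1 * F' u d"
  proof (rule DERIV_nonneg_imp_nondecreasing[where f = "\<lambda>t. F (u + t *\<^sub>R d) - t * F' u d"])
    fix t :: real assume "0 \<le> t"
    then show "\<exists>y. ((\<lambda>t. F (u + t *\<^sub>R d) - t * F' u d) has_real_derivative y) (at t) \<and> 0 \<le> y"
      using 1[of t] 2[of t] by (intro exI[of _ "F' (u + t *\<^sub>R d) d - F' u d"]) auto
  qed simp
  then show ?thesis by (simp add: d_def)
qed

text \<open>By Cauchy-Schwarz the left side is at least 6 S^2 + 4 S D + D^2 = 6 (S + D/3)^2 + D^2/3.
  The constant 1/3 is sharp, with equality for a = -d/3.\<close>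

lemma norm_power4_uniformly_convex:
  fixes a d :: "'a::real_inner"
  shows "norm (a + d) ^ 4 - norm a ^ 4 - 4 * (norm a)\<^sup>2 * (a \<bullet> d) \<ge> norm d ^ 4 / 3"
proof -
  define A S D where "A = a \<bullet> a" and "S = a \<bullet> d" and "D = d \<bullet> d"
  have "S\<^sup>2 \<le> A * D"
    using Cauchy_Schwarz_ineq[of a d] by (simp add: A_def S_def D_def)
  moreover have "0 \<le> 6 * (S + D / 3)\<^sup>2" by simp
  ultimately have "D\<^sup>2 / 3 \<le> 4 * S\<^sup>2 + D\<^sup>2 + 2 * (A * D) + 4 * S * D"
    by (simp add: power2_eq_square algebra_simps)
  also have "\<dots> = (A + 2 * S + D)\<^sup>2 - A\<^sup>2 - 4 * A * S"
    by (simp add: power2_eq_square algebra_simps)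
  finally have "D\<^sup>2 / 3 \<le> (A + 2 * S + D)\<^sup>2 - A\<^sup>2 - 4 * A * S" .
  moreover have "(a + d) \<bullet> (a + d) = A + 2 * S + D"
    by (simp add: A_def S_def D_def inner_commute inner_add_left inner_add_right)
  ultimately show ?thesis
    by (simp only: norm_power4_eq power2_norm_eq_inner A_def S_def D_def)
qed

locale quartic_model = smooth_convex f L for f :: "real^'n \<Rightarrow> real" and L +
  fixes x :: "real^'n" and M :: real
  assumes M_pos: "M > 0"
begin

abbreviation "\<rho> \<equiv> rho f x M"
abbreviation "\<Omega> \<equiv> Omega f x M"

text \<open>The first derivatives \<open>drho\<close>, \<open>dOmega\<close> and second derivatives
  \<open>hrho\<close>, \<open>hOmega\<close> of the two models are kept as explicit polynomials in
  \<open>y - x\<close>; the Hessians then differ only by a term linear in \<open>y - x\<close>, the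
  one that \<open>D3_le_D2\<close> controls.\<close>

definition drho :: "real^'n \<Rightarrow> real^'n \<Rightarrow> real"
  where "drho y e = D2 f x (y - x) e + M / 2 * ((y - x) \<bullet> (y - x)) * ((y - x) \<bullet> e)"

definition dOmega :: "real^'n \<Rightarrow> real^'n \<Rightarrow> real"
  where "dOmega y e = D1 f x e + D2 f x (y - x) e + 1/2 * D3 f x (y - x) (y - x) e
    + M / 2 * ((y - x) \<bullet> (y - x)) * ((y - x) \<bullet> e)"

definition hrho :: "real^'n \<Rightarrow> real^'n \<Rightarrow> real^'n \<Rightarrow> real"
  where "hrho y d e = D2 f x d e
    + M / 2 * (((y - x) \<bullet> (y - x)) * (d \<bullet> e) + 2 * ((y - x) \<bullet> d) * ((y - x) \<bullet> e))"

definition hOmega :: "real^'n \<Rightarrow> real^'n \<Rightarrow> real^'n \<Rightarrow> real"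
  where "hOmega y d e = hrho y d e + D3 f x (y - x) d e"

section \<open>The Hessian as a quadratic form and its trace\<close>

lemma vec_expansion: "v = (\<Sum>i\<in>UNIV. v $ i *\<^sub>R axis i 1)" for v :: "real^'n"
  using basis_expansion[of v] by (simp add: scalar_mult_eq_scaleR)

lemma D2_expansion: "D2 f x u v = (\<Sum>i\<in>UNIV. v $ i * D2 f x u (axis i 1))"
  by (subst vec_expansion[of v]) (simp add: blinfun.bilinear_simps)

lemma hessian_quadratic_form: "(hessian f x *v v) \<bullet> v = D2 f x v v"
proof -
  have "(hessian f x *v v) $ i = D2 f x v (axis i 1)" for i
    using D2_expansion[of "axis i 1" v]
    by (simp add: matrix_vector_mult_def hessian_def D2_symmetric[of x v] mult.commute)
  then show ?thesis
    unfolding inner_vec_def using D2_expansion[of v v] by (simp add: mult.commute)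
qed

lemma trace_hessian: "trace (hessian f x) = (\<Sum>i\<in>UNIV. D2 f x (axis i 1) (axis i 1))"
  by (simp add: trace_def hessian_def)

lemma trace_hessian_nonneg: "trace (hessian f x) \<ge> 0"
  by (simp add: trace_hessian sum_nonneg D2_nonneg)

lemma D2_Cauchy_Schwarz: "(D2 f x a b)\<^sup>2 \<le> D2 f x a a * D2 f x b b"
  by (rule symmetric_psd_Cauchy_Schwarz)
    (auto intro!: linearI D2_symmetric D2_nonneg simp: blinfun.bilinear_simps)

text \<open>No eigenvalues are involved. If \<open>w\<close> collects the numbers
  \<open>D2 f x d (axis i 1)\<close>, then \<open>D2 f x d d\<close> is the inner product of
  \<open>d\<close> and \<open>w\<close>, and Cauchy-Schwarz for the form \<open>D2 f x\<close>
  bounds |w|^2 by \<open>D2 f x d d\<close> times the trace; one factor \<open>D2 f x d d\<close>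
  cancels.\<close>

lemma D2_le_trace: "D2 f x d d \<le> trace (hessian f x) * (norm d)\<^sup>2"
proof (cases "D2 f x d d = 0")
  case True
  then show ?thesis using trace_hessian_nonneg by simp
next
  case False
  then have pos: "D2 f x d d > 0" using D2_nonneg[of x d] by linarith
  let ?w = "\<chi> i. D2 f x d (axis i 1)"
  have eq: "D2 f x d d = d \<bullet> ?w" by (subst D2_expansion) (simp add: inner_vec_def)
  have "?w \<bullet> ?w = (\<Sum>i\<in>UNIV. (D2 f x d (axis i 1))\<^sup>2)"
    by (simp add: inner_vec_def power2_eq_square)
  also have "\<dots> \<le> (\<Sum>i\<in>UNIV. D2 f x d d * D2 f x (axis i 1) (axis i 1))"
    by (intro sum_mono D2_Cauchy_Schwarz)
  also have "\<dots> = D2 f x d d * trace (hessian f x)"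
    by (simp add: trace_hessian sum_distrib_left)
  finally have "(D2 f x d d)\<^sup>2 \<le> (d \<bullet> d) * (D2 f x d d * trace (hessian f x))"
    using Cauchy_Schwarz_ineq[of d ?w] mult_left_mono[OF _ inner_ge_zero[of d]] order_trans
    unfolding eq[symmetric] by blast
  then have "D2 f x d d * D2 f x d d \<le> D2 f x d d * (trace (hessian f x) * (norm d)\<^sup>2)"
    unfolding power2_norm_eq_inner by (simp add: power2_eq_square mult_ac)
  then show ?thesis using pos by simp
qed

lemma rho_eq: "\<rho> y = 1/2 * D2 f x (y - x) (y - x) + M / 8 * ((y - x) \<bullet> (y - x))\<^sup>2"
  by (simp add: rho_def hessian_quadratic_form norm_power4_eq)

section \<open>Derivatives of the models\<close>

lemma D2_model_derivative:
  "((\<lambda>y. D2 f x (y - x) (y - x)) has_derivative (\<lambda>e. 2 * D2 f x (y - x) e)) (at y)"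
proof -
  have "((\<lambda>y. D2 f x (y - x) (y - x)) has_derivative
      (\<lambda>e. D2 f x (y - x) e + D2 f x e (y - x))) (at y)"
    by (rule has_derivative_eq_rhs, rule blinfun.FDERIV,
        rule bounded_linear.has_derivative[OF blinfun.bounded_linear_right])
      (auto intro!: derivative_eq_intros simp: blinfun.bilinear_simps)
  then show ?thesis by (simp add: D2_symmetric[of x _ "y - x"])
qed

lemma D3_model_derivative2:
  "((\<lambda>y. D3 f x (y - x) (y - x) a) has_derivative (\<lambda>e. 2 * D3 f x (y - x) e a)) (at y)"
proof -
  have "((\<lambda>y. D3 f x (y - x) (y - x)) has_derivative
      (\<lambda>e. D3 f x (y - x) e + D3 f x e (y - x))) (at y)"
    by (rule has_derivative_eq_rhs, rule blinfun.FDERIV,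
        rule bounded_linear.has_derivative[OF blinfun.bounded_linear_right])
      (auto intro!: derivative_eq_intros simp: blinfun.bilinear_simps)
  then have "((\<lambda>y. D3 f x (y - x) (y - x) a) has_derivative
      (\<lambda>e. (D3 f x (y - x) e + D3 f x e (y - x)) a)) (at y)"
    by (rule bounded_linear.has_derivative[OF blinfun.bounded_linear_left])
  then show ?thesis
    by (simp add: blinfun.add_left D3_symmetric1[of x _ "y - x"])
qed

text \<open>The product rule yields three terms, one for each slot, and the two symmetries of
  \<open>D3 f x\<close> make them equal.\<close>

lemma D3_model_derivative:
  "((\<lambda>y. D3 f x (y - x) (y - x) (y - x)) has_derivative (\<lambda>e. 3 * D3 f x (y - x) (y - x) e)) (at y)"
proof -
  have 1: "((\<lambda>y. D3 f x (y - x) (y - x)) has_derivative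
      (\<lambda>e. D3 f x (y - x) e + D3 f x e (y - x))) (at y)"
    by (rule has_derivative_eq_rhs, rule blinfun.FDERIV,
        rule bounded_linear.has_derivative[OF blinfun.bounded_linear_right])
      (auto intro!: derivative_eq_intros simp: blinfun.bilinear_simps)
  have "((\<lambda>y. D3 f x (y - x) (y - x) (y - x)) has_derivative
      (\<lambda>e. D3 f x (y - x) (y - x) e + (D3 f x (y - x) e + D3 f x e (y - x)) (y - x))) (at y)"
    by (rule has_derivative_eq_rhs, rule blinfun.FDERIV, rule 1)
      (auto intro!: derivative_eq_intros simp: blinfun.bilinear_simps)
  moreover have "(D3 f x (y - x) e + D3 f x e (y - x)) (y - x) = 2 * D3 f x (y - x) (y - x) e" for e
    by (simp add: blinfun.add_left D3_symmetric1[of x e "y - x"] D3_symmetric2[of x "y - x" e])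
  ultimately show ?thesis by simp
qed

lemma rho_derivative: "(\<rho> has_derivative drho y) (at y)"
  unfolding rho_eq[abs_def]
  by (rule has_derivative_eq_rhs, (rule derivative_intros D2_model_derivative)+)
    (simp add: fun_eq_iff drho_def inner_commute)

lemma Omega_derivative: "(\<Omega> has_derivative dOmega y) (at y)"
  unfolding Omega_def[abs_def] Phi_def norm_power4_eq
  by (rule has_derivative_eq_rhs,
      (rule derivative_intros D2_model_derivative D3_model_derivative
        bounded_linear.has_derivative[OF blinfun.bounded_linear_right])+)
    (simp add: fun_eq_iff dOmega_def inner_commute)

lemma drho_derivative: "((\<lambda>y. drho y e) has_derivative (\<lambda>d. hrho y d e)) (at y)"
  unfolding drho_def
  by (rule has_derivative_eq_rhs,
      (rule derivative_intros
        bounded_linear.has_derivative[OF blinfun.bounded_linear_left]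
        bounded_linear.has_derivative[OF blinfun.bounded_linear_right])+)
    (simp add: fun_eq_iff hrho_def inner_commute algebra_simps)

lemma dOmega_derivative: "((\<lambda>y. dOmega y e) has_derivative (\<lambda>d. hOmega y d e)) (at y)"
  unfolding dOmega_def
  by (rule has_derivative_eq_rhs,
      (rule derivative_intros D3_model_derivative2
        bounded_linear.has_derivative[OF blinfun.bounded_linear_left]
        bounded_linear.has_derivative[OF blinfun.bounded_linear_right])+)
    (simp add: fun_eq_iff hOmega_def hrho_def inner_commute algebra_simps)

lemma gradient_rho: "gradient \<rho> y \<bullet> e = drho y e"
  by (rule gradient_eqI[OF rho_derivative])

lemma gradient_Omega: "gradient \<Omega> y \<bullet> e = dOmega y e"
  by (rule gradient_eqI[OF Omega_derivative])

lemma gradient_f: "gradient f y \<bullet> e = D1 f y e"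
  by (rule gradient_eqI[OF D1])

lemma gradient_Omega_center: "gradient \<Omega> x = gradient f x"
  by (rule vector_eq_rdot[THEN iffD1]) (simp add: gradient_Omega gradient_f dOmega_def)

lemma bregman_rho: "bregman \<rho> u v = \<rho> v - \<rho> u - drho u (v - u)"
  by (simp add: bregman_def gradient_rho)

lemma hrho_nonneg: "hrho y d d \<ge> 0"
  using M_pos by (auto simp: hrho_def intro!: add_nonneg_nonneg mult_nonneg_nonneg D2_nonneg)

text \<open>The quadratic part contributes half of a nonnegative form, and uniform convexity of the
  fourth power contributes M/8 times 1/3. This is how Bregman distances are converted into step
  lengths.\<close>

lemma bregman_rho_ge: "bregman \<rho> u v \<ge> M / 24 * norm (v - u) ^ 4"
proof -
  define a where "a = u - x"
  define d where "d = v - u"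
  have v: "v - x = a + d" by (simp add: a_def d_def)
  have D: "D2 f x (a + d) (a + d) = D2 f x a a + 2 * D2 f x a d + D2 f x d d"
    by (simp add: blinfun.add_left blinfun.add_right D2_symmetric[of x d a])
  have "bregman \<rho> u v = 1/2 * D2 f x d d
    + M / 8 * (((a + d) \<bullet> (a + d))\<^sup>2 - (a \<bullet> a)\<^sup>2 - 4 * (a \<bullet> a) * (a \<bullet> d))"
    unfolding bregman_rho rho_eq drho_def v a_def[symmetric] d_def[symmetric] D
    by (simp only: ring_distribs)
  then have "bregman \<rho> u v = 1/2 * D2 f x d d
    + M / 8 * (norm (a + d) ^ 4 - norm a ^ 4 - 4 * (norm a)\<^sup>2 * (a \<bullet> d))"
    by (simp only: norm_power4_eq power2_norm_eq_inner)
  moreover have "M / 8 * (norm (a + d) ^ 4 - norm a ^ 4 - 4 * (norm a)\<^sup>2 * (a \<bullet> d))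
      \<ge> M / 8 * (norm d ^ 4 / 3)"
    using M_pos norm_power4_uniformly_convex[of d a] by (intro mult_left_mono) auto
  ultimately show ?thesis using D2_nonneg[of x d] by (simp add: d_def)
qed

lemma bregman_rho_nonneg: "bregman \<rho> u v \<ge> 0"
  using M_pos by (intro order_trans[OF _ bregman_rho_ge]) simp

lemma bregman_rho_center: "bregman \<rho> x v \<le> 1/2 * trace (hessian f x) * (norm (v - x))\<^sup>2 + M / 8 * norm (v - x) ^ 4"
  using D2_le_trace[of "v - x"] by (simp add: bregman_rho drho_def rho_eq norm_power4_eq)

lemma bregman_rho_three_point:
  "bregman \<rho> y z - bregman \<rho> y' z - bregman \<rho> y y' = (gradient \<rho> y' - gradient \<rho> y) \<bullet> (z - y')"
  by (simp add: bregman_def inner_diff_left inner_diff_right)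

text \<open>For the radius r = (96 |G| / M)^(1/3) the factor is exactly
  \<open>inner_L f x G M\<close>. The 3 is 1 + 2, from Cauchy-Schwarz applied to the rank-one part
  of the quartic Hessian.\<close>

lemma hrho_le:
  assumes "norm (y - x) \<le> r"
  shows "hrho y d d \<le> (trace (hessian f x) + 3 * M / 2 * r\<^sup>2) * (norm d)\<^sup>2"
proof -
  have "((y - x) \<bullet> d)\<^sup>2 \<le> (norm (y - x))\<^sup>2 * (norm d)\<^sup>2"
    using Cauchy_Schwarz_ineq[of "y - x" d] by (simp add: power2_norm_eq_inner)
  then have "hrho y d d \<le> D2 f x d d + M / 2 * (3 * ((norm (y - x))\<^sup>2 * (norm d)\<^sup>2))"
    using M_pos by (simp add: hrho_def power2_norm_eq_inner[symmetric] power2_eq_square mult_ac)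
  also have "\<dots> \<le> trace (hessian f x) * (norm d)\<^sup>2 + M / 2 * (3 * (r\<^sup>2 * (norm d)\<^sup>2))"
    using assms M_pos D2_le_trace
    by (intro add_mono mult_left_mono mult_right_mono power_mono) auto
  finally show ?thesis by (simp add: algebra_simps)
qed

lemma hOmega_bilinear_symmetric:
  shows "linear (\<lambda>a. 3 * hrho y a b - hOmega y a b)"
    and "linear (\<lambda>b. 3 * hrho y a b - hOmega y a b)"
    and "3 * hrho y a b - hOmega y a b = 3 * hrho y b a - hOmega y b a"
proof -
  show "linear (\<lambda>a. 3 * hrho y a b - hOmega y a b)"
    unfolding hOmega_def hrho_def
    by (rule linearI) (simp_all add: blinfun.add_left blinfun.scaleR_left
        blinfun.add_right blinfun.scaleR_right inner_add_left inner_add_right algebra_simps)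
  show "linear (\<lambda>b. 3 * hrho y a b - hOmega y a b)"
    unfolding hOmega_def hrho_def
    by (rule linearI) (simp_all add: blinfun.add_left blinfun.scaleR_left
        blinfun.add_right blinfun.scaleR_right inner_add_left inner_add_right algebra_simps)
  show "3 * hrho y a b - hOmega y a b = 3 * hrho y b a - hOmega y b a"
    using D2_symmetric[of x a b] D3_symmetric2[of x "y - x" a b]
    by (simp add: hOmega_def hrho_def inner_commute)
qed

text \<open>Adding back the gradient of the quartic regularizer leaves the gradient of f minus that
  of its cubic Taylor polynomial; testing this vector against itself in \<open>D1_taylor\<close>
  gives its norm.\<close>

lemma gradient_f_near_Omega:
  "norm (gradient f y - gradient \<Omega> y + (M / 2 * (norm (y - x))\<^sup>2) *\<^sub>R (y - x)) \<le> L / 6 * norm (y - x) ^ 3"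
proof -
  define h where "h = y - x"
  define g where "g = gradient f y - gradient \<Omega> y + (M / 2 * (norm h)\<^sup>2) *\<^sub>R h"
  have "g \<bullet> e = D1 f (x + h) e - D1 f x e - D2 f x h e - 1/2 * D3 f x h h e" for e
    unfolding g_def power2_norm_eq_inner
    by (simp add: gradient_Omega gradient_f dOmega_def inner_add_left inner_diff_left h_def)
  then have "g \<bullet> g \<le> L / 6 * norm h ^ 3 * norm g"
    using D1_taylor[of x h g] abs_ge_self order_trans by metis
  then have "norm g * norm g \<le> L / 6 * norm h ^ 3 * norm g"
    by (simp add: power2_norm_eq_inner[symmetric] power2_eq_square)
  then have "norm g \<le> L / 6 * norm h ^ 3"
    using L_nonneg by (cases "norm g = 0") auto
  then show ?thesis by (simp add: g_def h_def)
qed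

end

section \<open>Relative smoothness and strong convexity for M >= 4 L\<close>

locale majorizing_model = quartic_model f L x M for f :: "real^'n \<Rightarrow> real" and L x M +
  assumes L_le_M: "4 * L \<le> M"
begin

text \<open>\<open>L_le_M\<close> bounds the term L |y - x|^2 |d|^2 of \<open>D3_le_D2\<close> by
  half of the first quartic term of \<open>hrho\<close>; half of \<open>D2 f x d d\<close> is
  already there.\<close>

lemma D3_le_hrho: "\<bar>D3 f x (y - x) d d\<bar> \<le> 1/2 * hrho y d d"
proof -
  have "L * (norm (y - x))\<^sup>2 * (norm d)\<^sup>2 \<le> M / 4 * (norm (y - x))\<^sup>2 * (norm d)\<^sup>2"
    using L_le_M by (intro mult_right_mono) auto
  moreover have "0 \<le> M / 2 * ((y - x) \<bullet> d)\<^sup>2" using M_pos by simp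
  ultimately show ?thesis
    using D3_le_D2[of x "y - x" d]
    by (simp add: hrho_def power2_norm_eq_inner[symmetric] power2_eq_square algebra_simps)
qed

lemma Omega_lower: "\<Omega> u + gradient \<Omega> u \<bullet> (v - u) + 1/2 * bregman \<rho> u v \<le> \<Omega> v"
proof -
  have "(\<Omega> u - 1/2 * \<rho> u) + (dOmega u (v - u) - 1/2 * drho u (v - u)) \<le> \<Omega> v - 1/2 * \<rho> v"
  proof (rule convex_if_second_derivative_nonneg[where F = "\<lambda>y. \<Omega> y - 1/2 * \<rho> y"
      and F' = "\<lambda>y e. dOmega y e - 1/2 * drho y e" and F'' = "\<lambda>y d e. hOmega y d e - 1/2 * hrho y d e"])
    show "((\<lambda>y. \<Omega> y - 1/2 * \<rho> y) has_derivative (\<lambda>e. dOmega y e - 1/2 * drho y e)) (at y)" for y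
      by (intro derivative_intros Omega_derivative rho_derivative)
    show "((\<lambda>y. dOmega y e - 1/2 * drho y e) has_derivative (\<lambda>d. hOmega y d e - 1/2 * hrho y d e)) (at y)" for y e
      by (intro derivative_intros dOmega_derivative drho_derivative)
    show "0 \<le> hOmega y d d - 1/2 * hrho y d d" for y d
      using D3_le_hrho[of y d] by (simp add: hOmega_def)
  qed
  then show ?thesis unfolding bregman_rho gradient_Omega by (simp add: field_simps)
qed

lemma Omega_upper: "\<Omega> v \<le> \<Omega> u + gradient \<Omega> u \<bullet> (v - u) + 3/2 * bregman \<rho> u v"
proof -
  have "(3/2 * \<rho> u - \<Omega> u) + (3/2 * drho u (v - u) - dOmega u (v - u)) \<le> 3/2 * \<rho> v - \<Omega> v"
  proof (rule convex_if_second_derivative_nonneg[where F = "\<lambda>y. 3/2 * \<rho> y - \<Omega> y"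
      and F' = "\<lambda>y e. 3/2 * drho y e - dOmega y e" and F'' = "\<lambda>y d e. 3/2 * hrho y d e - hOmega y d e"])
    show "((\<lambda>y. 3/2 * \<rho> y - \<Omega> y) has_derivative (\<lambda>e. 3/2 * drho y e - dOmega y e)) (at y)" for y
      by (intro derivative_intros Omega_derivative rho_derivative)
    show "((\<lambda>y. 3/2 * drho y e - dOmega y e) has_derivative (\<lambda>d. 3/2 * hrho y d e - hOmega y d e)) (at y)" for y e
      by (intro derivative_intros dOmega_derivative drho_derivative)
    show "0 \<le> 3/2 * hrho y d d - hOmega y d d" for y d
      using D3_le_hrho[of y d] by (simp add: hOmega_def)
  qed
  then show ?thesis unfolding bregman_rho gradient_Omega by (simp add: field_simps)
qed

text \<open>Up to sign, the left side is the residual of one inner step from \<open>u\<close> to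
  \<open>v\<close>. The form 3 \<open>hrho\<close> - \<open>hOmega\<close> lies between 0 and 5/2
  \<open>hrho\<close>, so the mean value theorem, tested in the direction of the vector itself, and
  Cauchy-Schwarz for this form give the bound.\<close>

lemma gradient_difference_le:
  assumes u: "norm (u - x) \<le> r" and v: "norm (v - x) \<le> r"
  shows "norm (3 *\<^sub>R (gradient \<rho> v - gradient \<rho> u) - (gradient \<Omega> v - gradient \<Omega> u))
    \<le> 5/2 * (trace (hessian f x) + 3 * M / 2 * r\<^sup>2) * norm (v - u)"
proof -
  define C where "C = trace (hessian f x) + 3 * M / 2 * r\<^sup>2"
  have C: "C \<ge> 0" using trace_hessian_nonneg M_pos by (simp add: C_def)
  define d where "d = v - u"
  define g where "g = 3 *\<^sub>R (gradient \<rho> v - gradient \<rho> u) - (gradient \<Omega> v - gradient \<Omega> u)"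
  let ?q = "\<lambda>t. 3 * drho (u + t *\<^sub>R d) g - dOmega (u + t *\<^sub>R d) g"
  define B where "B = (\<lambda>y a b. 3 * hrho y a b - hOmega y a b)"
  have "(?q has_real_derivative B (u + t *\<^sub>R d) d g) (at t)" for t
    unfolding B_def
    by (intro DERIV_diff DERIV_cmult has_real_derivative_along_line[OF drho_derivative]
        has_real_derivative_along_line[OF dOmega_derivative])
  then obtain t where t: "0 < t" "t < 1" and eq: "?q 1 - ?q 0 = (1 - 0) * B (u + t *\<^sub>R d) d g"
    using MVT2[of 0 1 ?q "\<lambda>t. B (u + t *\<^sub>R d) d g"] zero_less_one by blast
  define y where "y = u + t *\<^sub>R d"
  have "y - x = (1 - t) *\<^sub>R (u - x) + t *\<^sub>R (v - x)" by (simp add: y_def d_def algebra_simps)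
  then have "norm (y - x) \<le> (1 - t) * norm (u - x) + t * norm (v - x)"
    using t norm_triangle_ineq[of "(1 - t) *\<^sub>R (u - x)" "t *\<^sub>R (v - x)"] by simp
  also have "\<dots> \<le> (1 - t) * r + t * r"
    using t u v by (intro add_mono mult_left_mono) auto
  finally have r: "norm (y - x) \<le> r" by (simp add: algebra_simps)
  have pos: "B y a a \<ge> 0" and le: "B y a a \<le> 5/2 * C * (norm a)\<^sup>2" for a
    using D3_le_hrho[of y a] hrho_nonneg[of y a] hrho_le[OF r, folded C_def, of a]
    by (auto simp: hOmega_def B_def)
  have "(B y d g)\<^sup>2 \<le> B y d d * B y g g"
    using pos unfolding B_def
    by (intro symmetric_psd_Cauchy_Schwarz hOmega_bilinear_symmetric(1,2))
      (rule hOmega_bilinear_symmetric(3))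
  also have "\<dots> \<le> (5/2 * C * (norm d)\<^sup>2) * (5/2 * C * (norm g)\<^sup>2)"
    using C by (intro mult_mono le pos) auto
  also have "\<dots> = (5/2 * C * norm d * norm g)\<^sup>2" by (simp add: power2_eq_square)
  finally have "B y d g \<le> 5/2 * C * norm d * norm g"
    by (rule power2_le_imp_le) (use C in simp)
  then have "?q 1 - ?q 0 \<le> 5/2 * C * norm d * norm g"
    using eq by (simp add: y_def)
  moreover have "g \<bullet> e = (3 * drho v e - dOmega v e) - (3 * drho u e - dOmega u e)" for e
    by (simp add: g_def gradient_rho gradient_Omega inner_diff_left algebra_simps)
  then have "?q 1 - ?q 0 = g \<bullet> g" by (simp add: d_def)
  ultimately have "norm g * norm g \<le> (5/2 * C * norm d) * norm g"
    by (simp add: power2_norm_eq_inner[symmetric] power2_eq_square)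
  then have "norm g \<le> 5/2 * C * norm d"
    using C by (cases "norm g = 0") auto
  then show ?thesis by (simp add: C_def g_def d_def)
qed

end

section \<open>Analysis of the inner solver\<close>

lemma econvex_real:
  assumes "econvex \<psi>" "x \<in> edom \<psi>"
  shows "\<psi> x = ereal (real_of_ereal (\<psi> x))"
  using assms by (cases "\<psi> x") (auto simp: econvex_def edom_def)

lemma composite_real:
  assumes "econvex \<psi>" "x \<in> edom \<psi>"
  shows "composite f \<psi> x = ereal (f x + real_of_ereal (\<psi> x))"
  unfolding composite_def by (subst econvex_real[OF assms]) simp

lemma subdiff_real:
  assumes "econvex \<psi>" "g \<in> subdiff \<psi> y" "z \<in> edom \<psi>"
  shows "real_of_ereal (\<psi> y) + g \<bullet> (z - y) \<le> real_of_ereal (\<psi> z)"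
proof -
  have "y \<in> edom \<psi>" "\<psi> y + ereal (g \<bullet> (z - y)) \<le> \<psi> z" using assms(2) by (auto simp: subdiff_def)
  then show ?thesis
    using econvex_real[OF assms(1), of y] econvex_real[OF assms(1), of z] assms(3)
    by (metis ereal_less_eq(3) plus_ereal.simps(1))
qed

text \<open>Along the segment to \<open>z\<close>, convexity replaces \<psi> by its chord, so only
  the smooth part has to be differentiated. The point \<open>x\<close> of finite value forces the
  minimizer into the domain.\<close>

lemma arg_min_variational_inequality:
  fixes \<phi> :: "'a::real_normed_vector \<Rightarrow> real"
  assumes ec: "econvex \<psi>" and \<phi>: "(\<phi> has_derivative \<phi>') (at y)"
    and min: "is_arg_min (\<lambda>z. ereal (\<phi> z) + \<psi> z) (\<lambda>_. True) y"
    and dom: "x \<in> edom \<psi>"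
  shows "y \<in> edom \<psi>" and "\<psi> y + ereal (- \<phi>' (z - y)) \<le> \<psi> z"
proof -
  have le: "ereal (\<phi> y) + \<psi> y \<le> ereal (\<phi> z) + \<psi> z" for z
    using min by (auto simp: is_arg_min_def not_less)
  show y: "y \<in> edom \<psi>"
    using le[of x] dom by (auto simp: edom_def)
  show "\<psi> y + ereal (- \<phi>' (z - y)) \<le> \<psi> z"
  proof (cases "z \<in> edom \<psi>")
    case False
    then show ?thesis by (simp add: edom_def)
  next
    case True
    define p where "p = real_of_ereal (\<psi> y)"
    define q where "q = real_of_ereal (\<psi> z)"
    have p: "\<psi> y = ereal p" and q: "\<psi> z = ereal q"
      using econvex_real[OF ec] y True by (auto simp: p_def q_def)
    define d where "d = z - y"
    \<comment> \<open>Up to the constant \<open>p\<close>, this majorizes the objective on the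
      segment and agrees with it at 0, so its right derivative at 0 cannot be negative.\<close>
    let ?k = "\<lambda>t. \<phi> (y + t *\<^sub>R d) - t * (p - q)"
    have k: "?k 0 \<le> ?k t" if t: "0 < t" "t < 1" for t
    proof -
      have eq: "y + t *\<^sub>R d = (1 - t) *\<^sub>R y + t *\<^sub>R z" by (simp add: d_def algebra_simps)
      have "\<psi> (y + t *\<^sub>R d) \<le> ereal (1 - t) * \<psi> y + ereal t * \<psi> z"
        unfolding eq using ec t unfolding econvex_def by simp
      also have "\<dots> = ereal ((1 - t) * p + t * q)" by (simp add: p q)
      finally have "ereal (\<phi> y) + \<psi> y \<le> ereal (\<phi> (y + t *\<^sub>R d)) + ereal ((1 - t) * p + t * q)"
        using le[of "y + t *\<^sub>R d"] by (meson add_left_mono order_trans)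
      then show ?thesis by (simp add: p algebra_simps)
    qed
    have "((\<lambda>t. \<phi> (y + t *\<^sub>R d)) has_real_derivative \<phi>' d) (at 0)"
      by (rule has_real_derivative_along_line) (simp add: \<phi>)
    then have D: "(?k has_real_derivative \<phi>' d - (p - q)) (at 0)"
      by (auto intro!: derivative_eq_intros)
    have "\<phi>' d - (p - q) \<ge> 0"
    proof (rule ccontr)
      assume "\<not> \<phi>' d - (p - q) \<ge> 0"
      with DERIV_neg_dec_right[OF D] obtain e where e: "e > 0"
        and dec: "\<And>h. h > 0 \<Longrightarrow> h < e \<Longrightarrow> ?k (0 + h) < ?k 0" by auto
      define h where "h = min e 1 / 2"
      have "h > 0" "h < e" "h < 1" using e by (auto simp: h_def min_def)
      with dec[of h] k[of h] show False by simp
    qed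
    then show ?thesis by (simp add: p q d_def)
  qed
qed

text \<open>Squaring the hypothesis isolates the inner product. In the scale-free variable \<gamma>
  = |G| / (M r^3) it gives -(G \<bullet> h) \<ge> (\<gamma>^2 + 119/576) M r^4, where 119/576 = 1/4
  - (5/24)^2; this exceeds (1 + \<gamma>^2)/6, and \<gamma>^(4/3) \<le> 1 + \<gamma>^2.\<close>

lemma quartic_descent:
  fixes G h :: "'a::real_inner"
  assumes M: "M > 0" and h: "h \<noteq> 0"
    and le: "norm (G + (M / 2 * (norm h)\<^sup>2) *\<^sub>R h) \<le> 5 * M / 24 * norm h ^ 3"
  shows "1 / (6 * M powr (1/3)) * norm G powr (4/3) \<le> - (G \<bullet> h)"
proof -
  define r where "r = norm h"
  define \<gamma> where "\<gamma> = norm G / (M * r ^ 3)"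
  have r: "r > 0" using h by (simp add: r_def)
  have G: "norm G = \<gamma> * (M * r ^ 3)" using M r by (simp add: \<gamma>_def)
  have \<gamma>: "\<gamma> \<ge> 0" using M r by (simp add: \<gamma>_def)
  have "(norm (G + (M / 2 * r\<^sup>2) *\<^sub>R h))\<^sup>2 \<le> (5 * M / 24 * r ^ 3)\<^sup>2"
    using le by (intro power_mono) (auto simp: r_def)
  moreover have "(norm (G + (M / 2 * r\<^sup>2) *\<^sub>R h))\<^sup>2 = (norm G)\<^sup>2 + M * r\<^sup>2 * (G \<bullet> h) + (M / 2 * r\<^sup>2)\<^sup>2 * r\<^sup>2"
    unfolding r_def power2_norm_eq_inner
    by (simp add: inner_add_left inner_add_right inner_commute power2_eq_square algebra_simps)
  ultimately have "(\<gamma>\<^sup>2 + 119/576) * (M * r ^ 4) * (M * r\<^sup>2) \<le> - (G \<bullet> h) * (M * r\<^sup>2)"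
    unfolding G by (simp add: power2_eq_square power3_eq_cube power4_eq_xxxx algebra_simps)
  then have 1: "(\<gamma>\<^sup>2 + 119/576) * (M * r ^ 4) \<le> - (G \<bullet> h)"
    by (rule mult_right_le_imp_le) (use M r in simp)
  have "\<gamma> powr (4/3) \<le> 1 + \<gamma>\<^sup>2"
  proof (cases "\<gamma> \<le> 1")
    case True
    then have "\<gamma> powr (4/3) \<le> 1" using \<gamma> by (intro powr_le1) auto
    then show ?thesis using zero_le_power2[of \<gamma>] by linarith
  next
    case False
    then have "\<gamma> powr (4/3) \<le> \<gamma> powr 2" by (intro powr_mono) auto
    then show ?thesis using False by (simp add: powr_numeral)
  qed
  then have "1/6 * \<gamma> powr (4/3) \<le> \<gamma>\<^sup>2 + 119/576"
    using zero_le_power2[of \<gamma>] by linarith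
  then have 2: "1/6 * \<gamma> powr (4/3) * (M * r ^ 4) \<le> (\<gamma>\<^sup>2 + 119/576) * (M * r ^ 4)"
    using M r by (intro mult_right_mono) auto
  have "(M * r ^ 3) powr (4/3) = M powr (4/3) * r ^ 4"
  proof -
    have "r ^ 3 = r powr 3" "r ^ 4 = r powr 4" using r by (simp_all add: powr_numeral)
    then show ?thesis using M r by (simp only: powr_mult powr_powr) simp
  qed
  moreover have "M powr (4/3) = M powr (1/3) * M"
    using M by (simp add: powr_add[of M "1/3" 1, simplified])
  ultimately have "norm G powr (4/3) = \<gamma> powr (4/3) * (M powr (1/3) * M * r ^ 4)"
    using M r \<gamma> by (simp add: G powr_mult)
  then have "1 / (6 * M powr (1/3)) * norm G powr (4/3) = 1/6 * \<gamma> powr (4/3) * (M * r ^ 4)"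
    using M by (simp add: field_simps)
  then show ?thesis using 1 2 by linarith
qed

context smooth_convex
begin

lemma composite_subgradient:
  fixes \<psi> :: "real^'n \<Rightarrow> ereal"
  assumes ec: "econvex \<psi>" and G: "G \<in> composite_subdiff f \<psi> y" and z: "z \<in> edom \<psi>"
  shows "f y + real_of_ereal (\<psi> y) + G \<bullet> (z - y) \<le> f z + real_of_ereal (\<psi> z)"
proof -
  obtain g where "g \<in> subdiff \<psi> y" "G = gradient f y + g"
    using G by (auto simp: composite_subdiff_def)
  then show ?thesis
    using tangent_le[of y z] subdiff_real[OF ec _ z, of g y]
    by (simp add: gradient_eqI[OF D1] inner_add_left)
qed

end

context quartic_model
begin

text \<open>\<open>inner_g\<close> is the negative gradient, at \<open>y'\<close>, of the smooth
  part of the subproblem, so first-order optimality says precisely this.\<close>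

lemma inner_step_optimality:
  fixes \<psi> :: "real^'n \<Rightarrow> ereal"
  assumes ec: "econvex \<psi>"
    and step: "inner_step f \<psi> x M y y'" and dom: "w \<in> edom \<psi>"
  shows "inner_g f x M y y' \<in> subdiff \<psi> y'"
proof -
  let ?\<phi> = "\<lambda>z. gradient \<Omega> y \<bullet> (z - y) + 3 * bregman \<rho> y z"
  have "(?\<phi> has_derivative (\<lambda>e. - inner_g f x M y y' \<bullet> e)) (at y')"
    unfolding bregman_def
    by (rule has_derivative_eq_rhs, (rule derivative_intros rho_derivative)+)
      (simp add: fun_eq_iff inner_g_def gradient_rho[symmetric] inner_add_left inner_diff_left algebra_simps)
  from arg_min_variational_inequality[OF ec this _ dom] step
  show ?thesis by (simp add: inner_step_def subdiff_def)
qed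

end

context majorizing_model
begin

context
  fixes \<psi> :: "real^'n \<Rightarrow> ereal"
  assumes ec: "econvex \<psi>"
begin

text \<open>Of the step constant 3, the upper model bound at \<open>y'\<close> uses up 3/2 and the
  lower bound at \<open>z\<close> uses up 1/2, which leaves the coefficients 3/2 and 5/2.\<close>

lemma inner_step_three_point:
  assumes step: "inner_step f \<psi> x M y y'" and z: "z \<in> edom \<psi>"
  shows "\<Omega> y' + real_of_ereal (\<psi> y') + 3 * bregman \<rho> y' z + 3/2 * bregman \<rho> y y'
    \<le> \<Omega> z + real_of_ereal (\<psi> z) + 5/2 * bregman \<rho> y z"
proof -
  have "real_of_ereal (\<psi> y') + inner_g f x M y y' \<bullet> (z - y') \<le> real_of_ereal (\<psi> z)"
    by (rule subdiff_real[OF ec inner_step_optimality[OF ec step z] z])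
  moreover have "inner_g f x M y y' \<bullet> (z - y') = - (gradient \<Omega> y \<bullet> (z - y')) - 3 * ((gradient \<rho> y' - gradient \<rho> y) \<bullet> (z - y'))"
    by (simp add: inner_g_def inner_add_left inner_diff_left)
  moreover have "gradient \<Omega> y \<bullet> (z - y) - gradient \<Omega> y \<bullet> (y' - y) = gradient \<Omega> y \<bullet> (z - y')"
    by (simp add: inner_diff_right)
  ultimately show ?thesis
    using Omega_lower[of y z] Omega_upper[of y' y] bregman_rho_three_point[of y z y'] by linarith
qed

lemma level_set_radius:
  assumes G: "G \<in> composite_subdiff f \<psi> x" and v: "v \<in> edom \<psi>"
    and le: "\<Omega> v + real_of_ereal (\<psi> v) \<le> \<Omega> x + real_of_ereal (\<psi> x)"
  shows "norm (v - x) \<le> (96 * norm G / M) powr (1/3)"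
proof -
  let ?r = "norm (v - x)"
  obtain g where g: "g \<in> subdiff \<psi> x" and Gg: "G = gradient f x + g"
    using G by (auto simp: composite_subdiff_def)
  have "G \<bullet> (v - x) + 1/2 * bregman \<rho> x v \<le> 0"
    using subdiff_real[OF ec g v] Omega_lower[of x v] le
    by (simp add: Gg gradient_Omega_center inner_add_left)
  moreover have "- (G \<bullet> (v - x)) \<le> norm G * ?r"
    using Cauchy_Schwarz_ineq2[of G "v - x"] by linarith
  ultimately have *: "M / 48 * ?r ^ 4 \<le> norm G * ?r"
    using bregman_rho_ge[of v x] by linarith
  have "?r ^ 3 \<le> 96 * norm G / M"
  proof (cases "?r = 0")
    case False
    have "M / 48 * ?r ^ 3 * ?r \<le> norm G * ?r"
      using * by (simp add: power4_eq_xxxx power3_eq_cube mult_ac)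
    then have "M / 48 * ?r ^ 3 \<le> norm G"
      using False by (subst (asm) mult_le_cancel_right) auto
    \<comment> \<open>The argument gives 48; the 96 of the algorithm leaves a factor 2 to
      spare.\<close>
    then have "M * ?r ^ 3 \<le> 96 * norm G" using norm_ge_zero[of G] by linarith
    then show ?thesis using M_pos by (simp add: field_simps)
  qed (use M_pos in simp)
  then have "(?r ^ 3) powr (1/3) \<le> (96 * norm G / M) powr (1/3)"
    by (intro powr_mono2) auto
  moreover have "(?r ^ 3) powr (1/3) = ?r"
  proof (cases "?r = 0")
    case False
    then have "?r ^ 3 = ?r powr 3" by (simp add: powr_numeral)
    then show ?thesis by (simp only: powr_powr) simp
  qed simp
  ultimately show ?thesis by simp
qed

text \<open>The linear rate is measured against the last iterate instead of a minimizer of the model;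
  the latter need not exist, as \<open>\<psi>\<close> is not assumed to be lower semicontinuous.\<close>

lemma inner_solver_no_failure:
  assumes G: "G \<in> composite_subdiff f \<psi> x" and y0: "y 0 = x"
    and step: "\<And>k. k \<le> N \<Longrightarrow> inner_step f \<psi> x M (y k) (y (Suc k))"
  shows "\<not> inner_failure f x G M N (y N) (y (Suc N))"
proof -
  let ?F = "\<lambda>v. \<Omega> v + real_of_ereal (\<psi> v)"
  define r where "r = (96 * norm G / M) powr (1/3)"
  have x: "x \<in> edom \<psi>" using G by (auto simp: composite_subdiff_def subdiff_def)
  have dom: "y k \<in> edom \<psi>" if "k \<le> Suc N" for k
    using that
  proof (cases k)
    case (Suc j)
    then show ?thesis
      using inner_step_optimality[OF ec step x, of j] that by (simp add: subdiff_def)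
  qed (simp add: y0 x)
  have dec: "?F (y (Suc k)) \<le> ?F (y k)" if "k \<le> N" for k
  proof -
    have "bregman \<rho> (y k) (y k) = 0" by (simp add: bregman_def)
    then show ?thesis
      using inner_step_three_point[OF step[OF that] dom[of k]] that
        bregman_rho_nonneg[of "y (Suc k)" "y k"] bregman_rho_nonneg[of "y k" "y (Suc k)"] by simp
  qed
  have le0: "?F (y k) \<le> ?F x" if "k \<le> Suc N" for k
    using that
  proof (induction k)
    case (Suc k)
    then show ?case using dec[of k] by simp
  qed (simp add: y0)
  \<comment> \<open>The last iterate has the smallest composite model value, so as reference point
    \<open>z\<close> it lets the function values drop out of the three-point inequality.\<close>
  have last: "?F (y (Suc N)) \<le> ?F (y (Suc k))" if "k \<le> N" for k
    using that
  proof (induction k rule: inc_induct)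
    case (step k)
    then show ?case using dec[of "Suc k"] by simp
  qed simp
  have ball: "norm (y k - x) \<le> r" if "k \<le> Suc N" for k
    unfolding r_def using level_set_radius[OF G dom[OF that] le0[OF that]] .
  have contract: "3 * bregman \<rho> (y (Suc k)) (y (Suc N)) + 3/2 * bregman \<rho> (y k) (y (Suc k))
      \<le> 5/2 * bregman \<rho> (y k) (y (Suc N))" if "k \<le> N" for k
    using inner_step_three_point[OF step[OF that] dom[of "Suc N"]] last[OF that] by simp
  have rate: "bregman \<rho> (y k) (y (Suc N)) \<le> (5/6) ^ k * bregman \<rho> x (y (Suc N))" if "k \<le> N" for k
    using that
  proof (induction k)
    case (Suc k)
    then show ?case
      using contract[of k] bregman_rho_nonneg[of "y k" "y (Suc k)"] by simp
  qed (simp add: y0)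
  have "r ^ n = (96 * norm G / M) powr (real n / 3)" if "n > 0" for n
  proof (cases "96 * norm G / M = 0")
    case False
    then show ?thesis unfolding r_def by (subst powr_power) simp_all
  qed (use that in \<open>auto simp: r_def\<close>)
  from this[of 2] this[of 4]
  have pw: "r\<^sup>2 = (96 * norm G / M) powr (2/3)" "r ^ 4 = (96 * norm G / M) powr (4/3)"
    by simp_all
  define K where "K = inner_L f x G M"
  have K: "K = trace (hessian f x) + 3 * M / 2 * r\<^sup>2" by (simp add: K_def inner_L_def pw)
  have K0: "K \<ge> 0" using trace_hessian_nonneg M_pos by (simp add: K)
  define b where "b = inner_beta f x G M"
  have b: "b = 1/2 * trace (hessian f x) * r\<^sup>2 + M / 8 * r ^ 4"
    by (simp add: b_def inner_beta_def pw)
  have b0: "b \<ge> 0" using trace_hessian_nonneg M_pos by (simp add: b)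
  have "bregman \<rho> x (y (Suc N)) \<le> 1/2 * trace (hessian f x) * (norm (y (Suc N) - x))\<^sup>2
      + M / 8 * norm (y (Suc N) - x) ^ 4"
    by (rule bregman_rho_center)
  also have "\<dots> \<le> b"
    unfolding b using ball[of "Suc N"] trace_hessian_nonneg M_pos
    by (intro add_mono mult_left_mono power_mono) auto
  finally have "(5/6) ^ N * bregman \<rho> x (y (Suc N)) \<le> (5/6) ^ N * b"
    by (rule mult_left_mono) simp
  \<comment> \<open>With the last iterate as reference, the distance at \<open>k = N\<close> is that
    of the final step, whose length controls the final residual.\<close>
  with rate[of N] have "bregman \<rho> (y N) (y (Suc N)) \<le> (5/6) ^ N * b" by linarith
  moreover have "M / 24 * norm (y (Suc N) - y N) ^ 4 \<le> bregman \<rho> (y N) (y (Suc N))"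
    by (rule bregman_rho_ge)
  ultimately have "24 / M * (M / 24 * norm (y (Suc N) - y N) ^ 4) \<le> 24 / M * ((5/6) ^ N * b)"
    using M_pos by (intro mult_left_mono) auto
  then have d4: "norm (y (Suc N) - y N) ^ 4 \<le> 24 / M * ((5/6) ^ N * b)"
    using M_pos by simp
  have "norm (inner_res f x M (y N) (y (Suc N)))
      = norm (3 *\<^sub>R (gradient \<rho> (y (Suc N)) - gradient \<rho> (y N)) - (gradient \<Omega> (y (Suc N)) - gradient \<Omega> (y N)))"
    by (subst norm_minus_cancel[symmetric]) (simp add: inner_res_def inner_g_def algebra_simps)
  also have "\<dots> \<le> 5/2 * K * norm (y (Suc N) - y N)"
    unfolding K by (rule gradient_difference_le) (simp_all add: ball)
  finally have "norm (inner_res f x M (y N) (y (Suc N))) ^ 4 \<le> (5/2 * K * norm (y (Suc N) - y N)) ^ 4"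
    by (intro power_mono) auto
  also have "\<dots> = (5/2) ^ 4 * K ^ 4 * norm (y (Suc N) - y N) ^ 4"
    by (simp only: power_mult_distrib)
  also have "\<dots> \<le> (5/2) ^ 4 * K ^ 4 * (24 / M * ((5/6) ^ N * b))"
    by (intro mult_left_mono d4) simp
  also have "\<dots> = ((5/2) ^ 4 * 24) * (K ^ 4 * b * (5/6) ^ N / M)" by simp
  \<comment> \<open>Numerically 937.5 \<le> 3280.5.\<close>
  also have "\<dots> \<le> (3 ^ 8 / 2) * (K ^ 4 * b * (5/6) ^ N / M)"
    using b0 M_pos by (intro mult_right_mono) (auto simp: power_divide)
  also have "(5/6) ^ N = 1 / (6/5 :: real) ^ N" by (simp add: power_divide)
  also have "3 ^ 8 / 2 * (K ^ 4 * b * (1 / (6/5) ^ N) / M) = 3 ^ 8 * K ^ 4 * b / (2 * M * (6/5) ^ N)"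
    by (simp add: mult_ac)
  finally show ?thesis
    by (simp add: inner_failure_def K_def b_def)
qed

text \<open>Either success test yields a residual of at most M/6 |h|^3. Adding the Taylor error, at
  most M/24 |h|^3, gives the 5 M/24 required by \<open>quartic_descent\<close>.\<close>

lemma success_imp_sufficient_decrease:
  assumes x: "x \<in> edom \<psi>" and g: "g \<in> subdiff \<psi> v"
    and res: "norm (gradient \<Omega> v + g) \<le> \<epsilon> / 7 \<or> norm (gradient \<Omega> v + g) \<le> M / 6 * norm (v - x) ^ 3"
    and \<epsilon>: "\<epsilon> > 0" "norm (gradient f v + g) \<ge> \<epsilon>"
  shows "sufficient_decrease f \<psi> x M v (gradient f v + g)"
proof -
  define G where "G = gradient f v + g"
  define h where "h = v - x"
  define q where "q = (M / 2 * (norm h)\<^sup>2) *\<^sub>R h"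
  have near: "norm (gradient f v - gradient \<Omega> v + q) \<le> M / 24 * norm h ^ 3"
  proof -
    have "norm (gradient f v - gradient \<Omega> v + q) \<le> L / 6 * norm h ^ 3"
      unfolding q_def h_def by (rule gradient_f_near_Omega)
    also have "\<dots> \<le> M / 24 * norm h ^ 3" using L_le_M by (intro mult_right_mono) auto
    finally show ?thesis .
  qed
  have q: "norm q = M / 2 * norm h ^ 3"
    using M_pos by (simp add: q_def power2_eq_square power3_eq_cube)
  have s: "G + q = (gradient f v - gradient \<Omega> v + q) + (gradient \<Omega> v + g)"
    by (simp add: G_def)
  have tri: "norm (G + q) \<le> M / 24 * norm h ^ 3 + norm (gradient \<Omega> v + g)"
    unfolding s using norm_triangle_ineq near by (meson add_right_mono order_trans)
  have res': "norm (gradient \<Omega> v + g) \<le> M / 6 * norm h ^ 3"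
  proof (cases "norm (gradient \<Omega> v + g) \<le> M / 6 * norm h ^ 3")
    \<comment> \<open>Here the residual is at most |G|/7, while |G| is at most the residual plus
      (1/24 + 1/2) M |h|^3. Hence six residuals are at most 13/24 M |h|^3, which is well within the
      cubic test.\<close>
    case False
    then have "norm (gradient \<Omega> v + g) \<le> norm G / 7"
      using res \<epsilon> by (simp add: G_def h_def)
    moreover have "norm G \<le> norm (G + q) + norm q"
      using norm_triangle_ineq4[of "G + q" q] by simp
    moreover have "0 \<le> M * norm h ^ 3" using M_pos by simp
    ultimately show ?thesis using tri q by (simp add: field_simps)
  qed
  then have le: "norm (G + q) \<le> 5 * M / 24 * norm h ^ 3" using tri by simp
  have "h \<noteq> 0"
  proof
    assume "h = 0"
    then have "G = 0" using le by (simp add: q_def)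
    then show False using \<epsilon> by (simp add: G_def)
  qed
  then have "1 / (6 * M powr (1/3)) * norm G powr (4/3) \<le> - (G \<bullet> h)"
    using M_pos le unfolding q_def by (intro quartic_descent)
  moreover have "v \<in> edom \<psi>" using g by (simp add: subdiff_def)
  moreover have "G \<in> composite_subdiff f \<psi> v" using g by (simp add: G_def composite_subdiff_def)
  from composite_subgradient[OF ec this x]
  have "- (G \<bullet> h) \<le> f x + real_of_ereal (\<psi> x) - (f v + real_of_ereal (\<psi> v))"
    by (simp add: h_def inner_diff_right)
  ultimately show ?thesis
    by (simp add: sufficient_decrease_def composite_real[OF ec] x G_def)
qed

end

end

section \<open>Convergence rates and the outer method\<close>

lemma doubly_logarithmic_phase:
  fixes u :: "nat \<Rightarrow> real"
  assumes dec: "\<And>t. t < m \<Longrightarrow> u (Suc t) powr (4/3) \<le> u t - u (Suc t)"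
    and gt: "\<And>t. t < m \<Longrightarrow> u t > 2" and m: "m > 0"
  shows "real m \<le> 1 + 1 / log 2 (4/3) * log 2 (log 2 (u 0))"
proof -
  have *: "(4/3) ^ t * log 2 (u t) \<le> log 2 (u 0)" if "t < m" for t
    using that
  proof (induction t)
    case (Suc t)
    have pos: "u t > 2" "u (Suc t) > 2" using gt Suc.prems by auto
    then have "u (Suc t) powr (4/3) \<le> u t" using dec[of t] Suc.prems by simp
    then have "log 2 (u (Suc t) powr (4/3)) \<le> log 2 (u t)"
      using pos by (subst log_le_cancel_iff) auto
    then have "4/3 * log 2 (u (Suc t)) \<le> log 2 (u t)"
      using pos by (simp add: log_powr)
    then have "(4/3) ^ t * (4/3 * log 2 (u (Suc t))) \<le> (4/3) ^ t * log 2 (u t)"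
      by (intro mult_left_mono) auto
    also have "\<dots> \<le> log 2 (u 0)" using Suc by simp
    finally show ?case by (simp add: mult_ac)
  qed simp
  \<comment> \<open>The last index known to lie above the threshold is \<open>m - 1\<close>, hence
    the summand 1 in the bound; the threshold 2 makes this logarithm exceed 1.\<close>
  have l: "log 2 (u (m - 1)) > 1" using gt[of "m - 1"] m by simp
  then have "(4/3) ^ (m - 1) * 1 \<le> (4/3) ^ (m - 1) * log 2 (u (m - 1))"
    by (intro mult_left_mono) auto
  also have "\<dots> \<le> log 2 (u 0)" using *[of "m - 1"] m by simp
  finally have le: "(4/3) ^ (m - 1) \<le> log 2 (u 0)" by simp
  have "log 2 ((4/3) ^ (m - 1)) \<le> log 2 (log 2 (u 0))"
    using le less_le_trans[OF zero_less_power le] by (subst log_le_cancel_iff) auto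
  then have "real (m - 1) * log 2 (4/3) \<le> log 2 (log 2 (u 0))"
    by (simp add: log_nat_power)
  moreover have "log 2 (4/3 :: real) > 0" by simp
  ultimately have "real (m - 1) \<le> 1 / log 2 (4/3) * log 2 (log 2 (u 0))"
    by (simp add: field_simps)
  then show ?thesis using m by (simp add: of_nat_diff)
qed

text \<open>With c = u^(1/3) the recursion reads c_{t+1}^3 (1 + c_{t+1}) \<le> c_t^3. The product
  form c_k (k - m) \<le> 7 of the growth of 1/c remains meaningful for c = 0 and starts trivially at
  k = m.\<close>

lemma cubic_rate_phase:
  fixes u :: "nat \<Rightarrow> real"
  assumes dec: "\<And>t. m \<le> t \<Longrightarrow> t < T \<Longrightarrow> u (Suc t) powr (4/3) \<le> u t - u (Suc t)"
    and nonneg: "\<And>t. t \<le> T \<Longrightarrow> u t \<ge> 0" and um: "u m \<le> 2"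
    and k: "m \<le> k" "k \<le> T"
  shows "u k * (real k - real m) ^ 3 \<le> 7 ^ 3"
proof -
  define c where "c t = u t powr (1/3)" for t
  have c0: "c t \<ge> 0" for t by (simp add: c_def)
  have c3: "c t ^ 3 = u t" if "t \<le> T" for t
  proof (cases "u t = 0")
    case False
    then show ?thesis using nonneg[OF that] unfolding c_def by (subst powr_power) simp_all
  qed (simp add: c_def)
  have c4: "c t ^ 4 = u t powr (4/3)" for t
  proof (cases "u t = 0")
    case False
    then show ?thesis unfolding c_def by (subst powr_power) simp_all
  qed (simp add: c_def)
  have u2: "u t \<le> 2" if "m \<le> t" "t \<le> T" for t
    using that
  proof (induction t rule: dec_induct)
    case (step t)
    then show ?case using dec[of t] powr_ge_zero[of "u (Suc t)" "4/3"] by linarith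
  qed (rule um)
  have "c k * (real k - real m) \<le> 7"
    using k
  proof (induction k rule: dec_induct)
    case (step t)
    define s where "s = c (Suc t) / 7"
    have s0: "s \<ge> 0" by (simp add: s_def c0)
    \<comment> \<open>13/10 is a rational upper bound for the cube root of 2.\<close>
    have "c (Suc t) ^ 3 \<le> (13/10) ^ 3"
      using c3[of "Suc t"] u2[of "Suc t"] step by (simp add: power3_eq_cube)
    then have "c (Suc t) \<le> 13/10" using c0 by (subst (asm) power_mono_iff) auto
    then have s1: "s \<le> 13/70" by (simp add: s_def)
    \<comment> \<open>The product is 1 + 4 s - 21 s^2, so s \<le> 4/21 is enough, and 13/70 < 4/21.
      It follows that c_{t+1} \<le> c_t (1 - s), and 7 s = c_{t+1} pays for the next index.\<close>
    have "1 \<le> (1 + 7 * s) * (1 - 3 * s)"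
    proof -
      have "s * s \<le> s * (4/21)" using s0 s1 by (intro mult_left_mono) auto
      then show ?thesis by (simp add: algebra_simps)
    qed
    also have "\<dots> \<le> (1 + 7 * s) * (1 - s) ^ 3"
    proof (intro mult_left_mono)
      have "0 \<le> s * s * (3 - s)" using s0 s1 by simp
      then show "1 - 3 * s \<le> (1 - s) ^ 3" by (simp add: power3_eq_cube algebra_simps)
    qed (use s0 in simp)
    finally have "c (Suc t) ^ 3 * 1 \<le> c (Suc t) ^ 3 * ((1 + 7 * s) * (1 - s) ^ 3)"
      using c0 by (intro mult_left_mono) auto
    also have "\<dots> = c (Suc t) ^ 3 * (1 + 7 * s) * (1 - s) ^ 3" by simp
    also have "c (Suc t) ^ 3 * (1 + 7 * s) = c (Suc t) ^ 3 + c (Suc t) ^ 4"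
      by (simp add: s_def power4_eq_xxxx power3_eq_cube algebra_simps)
    also have "(c (Suc t) ^ 3 + c (Suc t) ^ 4) * (1 - s) ^ 3 \<le> c t ^ 3 * (1 - s) ^ 3"
      using dec[of t] step c3[of t] c3[of "Suc t"] c4[of "Suc t"] s1
      by (intro mult_right_mono) auto
    finally have "c (Suc t) ^ 3 \<le> (c t * (1 - s)) ^ 3" by (simp add: power_mult_distrib)
    then have "c (Suc t) \<le> c t * (1 - s)"
      using c0 s1 by (subst (asm) power_mono_iff) auto
    then have "c (Suc t) * (real t - real m) \<le> c t * (1 - s) * (real t - real m)"
      using step by (intro mult_right_mono) auto
    also have "\<dots> = c t * (real t - real m) * (1 - s)" by simp
    also have "\<dots> \<le> 7 * (1 - s)" using step s1 by (intro mult_right_mono) auto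
    finally show ?case by (simp add: s_def algebra_simps)
  qed simp
  then have "(c k * (real k - real m)) ^ 3 \<le> 7 ^ 3"
    using c0 k by (intro power_mono) auto
  then show ?thesis using c3[OF k(2)] by (simp add: power_mult_distrib)
qed

context smooth_convex
begin

text \<open>Stated for every positive \<open>M\<close>, because an accepted trial may have
  \<open>M\<close> below \<open>4 * L\<close>.\<close>

lemma inner_solver_subgradient:
  assumes ec: "econvex \<psi>" and M: "M > 0" and x: "x \<in> edom \<psi>"
    and run: "inner_solver f \<psi> x G M \<epsilon> xp \<alpha> g"
  shows "g \<in> subdiff \<psi> xp"
proof -
  interpret quartic_model f L x M using M by unfold_locales
  obtain y N where "inner_step f \<psi> x M (y N) (y (Suc N))" "xp = y (Suc N)"
      "g = inner_g f x M (y N) (y (Suc N))"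
    using run by (auto simp: inner_solver_def)
  then show ?thesis using inner_step_optimality[OF ec _ x] by simp
qed

text \<open>Read contrapositively: a rejected trial has coefficient below \<open>4 * L\<close>,
  which is what bounds the estimates \<open>M t\<close>.\<close>

lemma large_M_trial_accepted:
  assumes ec: "econvex \<psi>" and M: "M > 0" "4 * L \<le> M" and G: "G \<in> composite_subdiff f \<psi> x"
    and run: "inner_solver f \<psi> x G M \<epsilon> xp \<alpha> g"
    and \<epsilon>: "\<epsilon> > 0" "norm (gradient f xp + g) \<ge> \<epsilon>"
  shows "\<alpha> = 0" and "sufficient_decrease f \<psi> x M xp (gradient f xp + g)"
proof -
  interpret majorizing_model f L x M using M by unfold_locales
  have x: "x \<in> edom \<psi>" using G by (auto simp: composite_subdiff_def subdiff_def)
  obtain y N where y0: "y 0 = x"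
    and step: "\<And>k. k \<le> N \<Longrightarrow> inner_step f \<psi> x M (y k) (y (Suc k))"
    and stop: "if inner_success f x M \<epsilon> (y N) (y (Suc N)) then \<alpha> = 0
       else inner_failure f x G M N (y N) (y (Suc N)) \<and> \<alpha> = 1"
    and xp: "xp = y (Suc N)" and g: "g = inner_g f x M (y N) (y (Suc N))"
    using run unfolding inner_solver_def by blast
  have succ: "inner_success f x M \<epsilon> (y N) (y (Suc N))"
    using stop inner_solver_no_failure[OF ec G y0 step] by (meson le_refl)
  with stop show "\<alpha> = 0" by simp
  show "sufficient_decrease f \<psi> x M xp (gradient f xp + g)"
    using succ inner_solver_subgradient[OF ec M(1) x run] \<epsilon>
    by (intro success_imp_sufficient_decrease[OF ec x])
      (auto simp: inner_success_def inner_res_def xp g)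
qed

end

lemma first_trial_minimal:
  assumes "first_trial M0 M = Suc i"
  shows "2 ^ i * M < 2 * M0"
  using not_less_Least[of i "\<lambda>i. 2 ^ i * M \<ge> 2 * M0"] assms by (auto simp: first_trial_def)

section \<open>Bounds along a run of the outer method\<close>

locale outer_method = smooth_convex f L for f :: "real^'n \<Rightarrow> real" and L +
  fixes \<psi> :: "real^'n \<Rightarrow> ereal" and x0 :: "real^'n" and M0 \<epsilon> :: real and T :: nat
    and x G :: "nat \<Rightarrow> real^'n" and M :: "nat \<Rightarrow> real" and it :: "nat \<Rightarrow> nat"
    and xp Gp :: "nat \<Rightarrow> nat \<Rightarrow> real^'n" and \<alpha> :: "nat \<Rightarrow> nat \<Rightarrow> nat"
  assumes ec: "econvex \<psi>" and eps_pos: "\<epsilon> > 0" and M0_pos: "M0 > 0"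
    and run: "outer_run f \<psi> x0 M0 \<epsilon> T x G M it xp \<alpha> Gp"
    and large_gradients: "\<And>t i. t \<le> T \<Longrightarrow> i \<in> {first_trial M0 (M t)..it t} \<Longrightarrow> \<epsilon> \<le> norm (Gp t i)"
begin

lemma start: "x 0 = x0" "M 0 = M0" "G 0 \<in> composite_subdiff f \<psi> x0"
  using run by (auto simp: outer_run_def)

lemma iteration:
  assumes "t \<le> T"
  shows "first_trial M0 (M t) \<le> it t"
    and "\<And>i. i \<in> {first_trial M0 (M t)..it t} \<Longrightarrow>
        \<exists>g. inner_solver f \<psi> (x t) (G t) (2 ^ i * M t) \<epsilon> (xp t i) (\<alpha> t i) g \<and>
            Gp t i = gradient f (xp t i) + g"
    and "\<And>i. i \<in> {first_trial M0 (M t)..<it t} \<Longrightarrow>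
        \<alpha> t i = 1 \<or> \<not> sufficient_decrease f \<psi> (x t) (2 ^ i * M t) (xp t i) (Gp t i)"
    and "sufficient_decrease f \<psi> (x t) (2 ^ it t * M t) (x (Suc t)) (G (Suc t))"
    and "x (Suc t) = xp t (it t)" and "G (Suc t) = Gp t (it t)"
    and "M (Suc t) = 2 ^ it t * M t / 2"
proof -
  have r: "first_trial M0 (M t) \<le> it t \<and>
      (\<forall>i\<in>{first_trial M0 (M t)..it t}.
        \<exists>g. inner_solver f \<psi> (x t) (G t) (2 ^ i * M t) \<epsilon> (xp t i) (\<alpha> t i) g \<and>
            Gp t i = gradient f (xp t i) + g) \<and>
      (\<forall>i\<in>{first_trial M0 (M t)..<it t}.
        \<alpha> t i = 1 \<or>
        (norm (Gp t i) > \<epsilon> \<and>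
         \<not> sufficient_decrease f \<psi> (x t) (2 ^ i * M t) (xp t i) (Gp t i))) \<and>
      sufficient_decrease f \<psi> (x t) (2 ^ it t * M t) (xp t (it t)) (Gp t (it t)) \<and>
      x (Suc t) = xp t (it t) \<and> G (Suc t) = Gp t (it t) \<and>
      M (Suc t) = 2 powi (int (it t) - 1) * M t"
    using run assms unfolding outer_run_def by blast
  then show "first_trial M0 (M t) \<le> it t"
    and "\<And>i. i \<in> {first_trial M0 (M t)..it t} \<Longrightarrow>
        \<exists>g. inner_solver f \<psi> (x t) (G t) (2 ^ i * M t) \<epsilon> (xp t i) (\<alpha> t i) g \<and>
            Gp t i = gradient f (xp t i) + g"
    and "\<And>i. i \<in> {first_trial M0 (M t)..<it t} \<Longrightarrow>
        \<alpha> t i = 1 \<or> \<not> sufficient_decrease f \<psi> (x t) (2 ^ i * M t) (xp t i) (Gp t i)"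
    and "x (Suc t) = xp t (it t)" and "G (Suc t) = Gp t (it t)" by blast+
  show "sufficient_decrease f \<psi> (x t) (2 ^ it t * M t) (x (Suc t)) (G (Suc t))"
    using r by simp
  show "M (Suc t) = 2 ^ it t * M t / 2"
    using r by (simp add: power_int_diff)
qed

lemma M_pos: "t \<le> Suc T \<Longrightarrow> M t > 0"
proof (induction t)
  case (Suc t)
  have "M (Suc t) = 2 ^ it t * M t / 2" using Suc.prems by (intro iteration(7)) simp
  also have "\<dots> > 0" using Suc by simp
  finally show ?case .
qed (simp add: start M0_pos)

lemma iterate_subgradient: "t \<le> Suc T \<Longrightarrow> G t \<in> composite_subdiff f \<psi> (x t)"
proof (induction t)
  case (Suc t)
  then have t: "t \<le> T" by simp
  have "x t \<in> edom \<psi>" using Suc by (auto simp: composite_subdiff_def subdiff_def)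
  moreover have "it t \<in> {first_trial M0 (M t)..it t}" using iteration(1)[OF t] by simp
  ultimately show ?case
    using iteration(2)[OF t, of "it t"] M_pos[of t] t
    by (auto simp: iteration(5,6)[OF t] composite_subdiff_def
        dest!: inner_solver_subgradient[OF ec, rotated 2])
qed (simp add: start)

lemma iterate_dom: "t \<le> Suc T \<Longrightarrow> x t \<in> edom \<psi>"
  using iterate_subgradient[of t] by (auto simp: composite_subdiff_def subdiff_def)

text \<open>If \<open>it t = 0\<close>, the estimate is halved. Otherwise \<open>M (Suc t)\<close>
  is the coefficient of index \<open>it t - 1\<close>: either it precedes the first trial and is
  below \<open>2 * M0\<close> by minimality, or it was tried and rejected.\<close>

lemma M_le: "t \<le> Suc T \<Longrightarrow> M t \<le> max (2 * M0) (4 * L)"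
proof (induction t)
  case (Suc t)
  then have t: "t \<le> T" by simp
  show ?case
  proof (cases "it t")
    case 0
    then show ?thesis using iteration(7)[OF t] Suc M_pos[of t] by simp
  next
    case (Suc i)
    have eq: "M (Suc t) = 2 ^ i * M t" using iteration(7)[OF t] by (simp add: Suc)
    show ?thesis
    proof (cases "first_trial M0 (M t) = it t")
      case True
      then show ?thesis using first_trial_minimal[of M0 "M t" i] Suc eq by simp
    next
      case False
      then have i: "i \<in> {first_trial M0 (M t)..<it t}" using iteration(1)[OF t] Suc by simp
      then have i': "i \<in> {first_trial M0 (M t)..it t}" by simp
      obtain g where g: "inner_solver f \<psi> (x t) (G t) (2 ^ i * M t) \<epsilon> (xp t i) (\<alpha> t i) g"
        and Gp: "Gp t i = gradient f (xp t i) + g"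
        using iteration(2)[OF t i'] by blast
      have "\<not> 4 * L \<le> 2 ^ i * M t"
      proof
        assume "4 * L \<le> 2 ^ i * M t"
        from large_M_trial_accepted[OF ec _ this iterate_subgradient g eps_pos]
        show False
          using iteration(3)[OF t i] large_gradients[OF t i'] M_pos[of t] t by (simp add: Gp)
      qed
      then show ?thesis using eq by simp
    qed
  qed
qed (use M0_pos in \<open>simp add: start le_max_iff_disj\<close>)

text \<open>Agrees with \<open>composite f \<psi>\<close> only on \<open>edom \<psi>\<close>, since
  \<open>real_of_ereal\<close> sends infinity to 0; all iterates and the minimizer lie
  there.\<close>

definition obj :: "real^'n \<Rightarrow> real"
  where "obj y = f y + real_of_ereal (\<psi> y)"

text \<open>The accepted coefficient is twice \<open>M (Suc t)\<close>, so doubling the bound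
  \<open>M_le\<close> produces the maximum that appears in the final rates.\<close>

lemma obj_decrease:
  assumes "t \<le> T"
  shows "1 / (6 * max (4 * M0) (8 * L) powr (1/3)) * norm (G (Suc t)) powr (4/3) \<le> obj (x t) - obj (x (Suc t))"
proof -
  have M: "2 ^ it t * M t > 0" using M_pos[of t] assms by simp
  have le: "2 ^ it t * M t \<le> max (4 * M0) (8 * L)"
    using iteration(7)[OF assms] M_le[of "Suc t"] assms by (simp add: max_def split: if_splits)
  have "1 / (6 * max (4 * M0) (8 * L) powr (1/3)) * norm (G (Suc t)) powr (4/3)
      \<le> 1 / (6 * (2 ^ it t * M t) powr (1/3)) * norm (G (Suc t)) powr (4/3)"
    using M le by (intro mult_right_mono divide_left_mono mult_left_mono powr_mono2 mult_pos_pos) auto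
  also have "\<dots> \<le> obj (x t) - obj (x (Suc t))"
    using iteration(4)[OF assms] assms iterate_dom
    by (simp add: sufficient_decrease_def composite_real[OF ec] obj_def)
  finally show ?thesis .
qed

lemma obj_le_start: "t \<le> Suc T \<Longrightarrow> obj (x t) \<le> obj (x 0)"
proof (induction t)
  case (Suc t)
  have "0 \<le> 1 / (6 * max (4 * M0) (8 * L) powr (1/3)) * norm (G (Suc t)) powr (4/3)" by simp
  also have "\<dots> \<le> obj (x t) - obj (x (Suc t))" using Suc by (intro obj_decrease) simp
  finally show ?case using Suc by simp
qed simp

text \<open>Convexity bounds the new gap by |G_{t+1}| R, and \<open>obj_decrease\<close> turns this
  into a decrease. Since K^(1/3) = 6 H^(1/3) R^(4/3), division by \<open>K\<close> removes every
  constant.\<close>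

lemma gap_recursion:
  assumes t: "t \<le> T" and xs: "xs \<in> edom \<psi>" and opt: "obj xs \<le> obj (x (Suc t))"
    and R: "norm (x (Suc t) - xs) \<le> R" "R > 0"
  defines "K \<equiv> 6 ^ 3 * (max (4 * M0) (8 * L) * R ^ 4)"
  shows "((obj (x (Suc t)) - obj xs) / K) powr (4/3)
    \<le> (obj (x t) - obj xs) / K - (obj (x (Suc t)) - obj xs) / K"
proof -
  define H where "H = max (4 * M0) (8 * L)"
  define \<delta> where "\<delta> = obj (x (Suc t)) - obj xs"
  have H: "H > 0" using M0_pos by (simp add: H_def)
  have K: "K = 6 ^ 3 * (H * R ^ 4)" by (simp add: K_def H_def)
  have Kpos: "K > 0" using H R by (simp add: K)
  have \<delta>: "\<delta> \<ge> 0" using opt by (simp add: \<delta>_def)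
  have "\<delta> \<le> - (G (Suc t) \<bullet> (xs - x (Suc t)))"
    using composite_subgradient[OF ec iterate_subgradient xs, of "Suc t"] t by (simp add: \<delta>_def obj_def)
  also have "\<dots> \<le> norm (G (Suc t)) * norm (x (Suc t) - xs)"
    using Cauchy_Schwarz_ineq2[of "G (Suc t)" "xs - x (Suc t)"] by (simp add: norm_minus_commute)
  also have "\<dots> \<le> norm (G (Suc t)) * R" using R by (intro mult_left_mono) auto
  finally have "\<delta> / R \<le> norm (G (Suc t))" using R by (simp add: field_simps)
  then have "(\<delta> / R) powr (4/3) \<le> norm (G (Suc t)) powr (4/3)"
    using \<delta> R by (intro powr_mono2) auto
  then have "1 / (6 * H powr (1/3)) * (\<delta> / R) powr (4/3) \<le> 1 / (6 * H powr (1/3)) * norm (G (Suc t)) powr (4/3)"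
    by (intro mult_left_mono) auto
  also have "\<dots> \<le> obj (x t) - obj (x (Suc t))" unfolding H_def by (rule obj_decrease[OF t])
  finally have main: "1 / (6 * H powr (1/3)) * (\<delta> / R) powr (4/3) \<le> obj (x t) - obj (x (Suc t))" .
  have "K powr (1/3) = 6 * H powr (1/3) * R powr (4/3)"
  proof -
    have "R ^ 4 = R powr 4" using R by (simp add: powr_numeral)
    moreover have "(6 ^ 3 :: real) powr (1/3) = 6"
      using powr_powr[of 6 3 "1/3"] by (simp add: powr_numeral)
    ultimately show ?thesis unfolding K using H R
      by (simp only: powr_mult powr_powr) simp
  qed
  moreover have "K powr (4/3) = K * K powr (1/3)"
    using Kpos by (simp add: powr_add[of K 1 "1/3", simplified])
  ultimately have "(\<delta> / K) powr (4/3) = 1 / (6 * H powr (1/3)) * (\<delta> / R) powr (4/3) / K"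
    using \<delta> R Kpos by (simp add: powr_divide)
  also have "\<dots> \<le> (obj (x t) - obj (x (Suc t))) / K"
    using main Kpos by (intro divide_right_mono) auto
  also have "\<dots> = (obj (x t) - obj xs) / K - \<delta> / K"
    by (simp add: \<delta>_def diff_divide_distrib)
  finally show ?thesis by (simp add: \<delta>_def)
qed

end

text \<open>The case \<open>m = 0\<close> is separated because the normalized initial gap is then at
  most 2: just above 1 the iterated logarithm is arbitrarily negative, and at or below 1 the outer
  logarithm has a nonpositive argument.\<close>

theorem theorem3p1:
  fixes f :: "real^'n \<Rightarrow> real" and \<psi> :: "real^'n \<Rightarrow> ereal"
    and L\<^sub>f R\<^sub>0 M\<^sub>0 \<epsilon> :: real and x\<^sub>0 x\<^sub>s :: "real^'n" and T m :: nat
    and x G :: "nat \<Rightarrow> real^'n" and M :: "nat \<Rightarrow> real" and it :: "nat \<Rightarrow> nat"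
    and xp Gp :: "nat \<Rightarrow> nat \<Rightarrow> real^'n" and \<alpha> :: "nat \<Rightarrow> nat \<Rightarrow> nat"
  assumes "convex_on UNIV f" and "three_times_differentiable f"
    and "\<forall>y z. norm (D3 f y - D3 f z) \<le> L\<^sub>f * norm (y - z)"
    and "econvex \<psi>"
    and "\<forall>y. composite f \<psi> x\<^sub>s \<le> composite f \<psi> y"
    and "x\<^sub>0 \<in> edom \<psi>"
    and "R\<^sub>0 > 0"
    and "\<forall>y. composite f \<psi> y \<le> composite f \<psi> x\<^sub>0 \<longrightarrow> norm (y - x\<^sub>s) \<le> R\<^sub>0"
    and "\<epsilon> > 0" and "M\<^sub>0 > 0"
    and "outer_run f \<psi> x\<^sub>0 M\<^sub>0 \<epsilon> T x G M it xp \<alpha> Gp"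
    and "\<forall>t\<le>T. \<forall>i\<in>{first_trial M\<^sub>0 (M t)..it t}.
      min (ereal (norm (Gp t i))) (composite f \<psi> (xp t i) - composite f \<psi> x\<^sub>s) \<ge> ereal \<epsilon>"
    and "composite f \<psi> (x m) - composite f \<psi> x\<^sub>s
      \<le> ereal (6 ^ 3 * (4 * max (2 * M\<^sub>0) (4 * L\<^sub>f) * R\<^sub>0 ^ 4))"
    and "\<forall>j<m. \<not> (composite f \<psi> (x j) - composite f \<psi> x\<^sub>s
      \<le> ereal (6 ^ 3 * (4 * max (2 * M\<^sub>0) (4 * L\<^sub>f) * R\<^sub>0 ^ 4)))"
    and "T > m"
  shows "(m = 0 \<or>
      real m \<le> 1 + 1 / log 2 (4/3) *
        log 2 (log 2 (real_of_ereal (composite f \<psi> x\<^sub>0 - composite f \<psi> x\<^sub>s)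
          / (6 ^ 3 * (max (4 * M\<^sub>0) (8 * L\<^sub>f) * R\<^sub>0 ^ 4))))) \<and>
    (\<forall>k. m \<le> k \<and> k \<le> T \<longrightarrow>
      composite f \<psi> (x k) - composite f \<psi> x\<^sub>s
        \<le> ereal (42 ^ 3 * max (4 * M\<^sub>0) (8 * L\<^sub>f) * R\<^sub>0 ^ 4) / ereal ((real k - real m) ^ 3)) \<and>
    real T \<le> real m + 42 * max (4 * M\<^sub>0) (8 * L\<^sub>f) powr (1/3) * R\<^sub>0 powr (4/3) * \<epsilon> powr (-1/3)"
proof -
  note convex = assms(1) and diff = assms(2) and lip = assms(3) and ec = assms(4)
    and opt = assms(5) and dom0 = assms(6) and R_pos = assms(7) and level = assms(8)
    and gap_ge = assms(12) and small_m = assms(13) and large_before_m = assms(14) and mT = assms(15)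
  have "\<epsilon> \<le> norm (Gp t i)" if "t \<le> T" "i \<in> {first_trial M\<^sub>0 (M t)..it t}" for t i
  proof -
    have "ereal \<epsilon> \<le> min (ereal (norm (Gp t i))) (composite f \<psi> (xp t i) - composite f \<psi> x\<^sub>s)"
      using gap_ge that by blast
    then show ?thesis by simp
  qed
  then interpret outer_method f L\<^sub>f \<psi> x\<^sub>0 M\<^sub>0 \<epsilon> T x G M it xp Gp \<alpha>
    using assms by unfold_locales auto
  define H where "H = max (4 * M\<^sub>0) (8 * L\<^sub>f)"
  define K where "K = 6 ^ 3 * (H * R\<^sub>0 ^ 4)"
  have H: "H > 0" using M0_pos by (simp add: H_def)
  have K: "K > 0" using H R_pos by (simp add: K_def)
  \<comment> \<open>The threshold that defines \<open>m\<close> is 2 in units of \<open>K\<close>,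
    the value at which the two scalar phases meet.\<close>
  have twoK: "6 ^ 3 * (4 * max (2 * M\<^sub>0) (4 * L\<^sub>f) * R\<^sub>0 ^ 4) = 2 * K"
    by (simp add: K_def H_def max_def)
  have comp: "composite f \<psi> y = ereal (obj y)" if "y \<in> edom \<psi>" for y
    using composite_real[OF ec that] by (simp add: obj_def)
  have xs: "x\<^sub>s \<in> edom \<psi>"
  proof -
    have "composite f \<psi> x\<^sub>s \<le> ereal (obj x\<^sub>0)" using opt comp[OF dom0] by metis
    then show ?thesis by (cases "\<psi> x\<^sub>s") (auto simp: edom_def composite_def)
  qed
  have opt': "obj x\<^sub>s \<le> obj y" if "y \<in> edom \<psi>" for y
    using opt[rule_format, of y] comp[OF xs] comp[OF that] by simp
  define \<delta> where "\<delta> t = obj (x t) - obj x\<^sub>s" for t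
  have gap: "composite f \<psi> (x t) - composite f \<psi> x\<^sub>s = ereal (\<delta> t)" if "t \<le> Suc T" for t
    using comp[OF iterate_dom[OF that]] comp[OF xs] by (simp add: \<delta>_def)
  have \<delta>0: "\<delta> t \<ge> 0" if "t \<le> Suc T" for t
    using opt'[OF iterate_dom[OF that]] by (simp add: \<delta>_def)
  have radius: "norm (x t - x\<^sub>s) \<le> R\<^sub>0" if "t \<le> Suc T" for t
    using level[rule_format, of "x t"] obj_le_start[OF that] comp[OF iterate_dom[OF that]]
      comp[OF dom0] by (simp add: start)
  define u where "u t = \<delta> t / K" for t
  have rec: "u (Suc t) powr (4/3) \<le> u t - u (Suc t)" if "t \<le> T" for t
    unfolding u_def \<delta>_def K_def H_def
    using that by (intro gap_recursion xs opt' iterate_dom radius R_pos) auto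
  have um: "u m \<le> 2"
    using small_m mT K unfolding twoK by (simp add: gap u_def field_simps)
  have uj: "u j > 2" if "j < m" for j
    using large_before_m[rule_format, OF that] that mT K unfolding twoK
    by (simp add: gap u_def field_simps)
  have "m = 0 \<or> real m \<le> 1 + 1 / log 2 (4/3) * log 2 (log 2 (u 0))"
    using doubly_logarithmic_phase[of m u] rec uj mT by force
  moreover have "u 0 = real_of_ereal (composite f \<psi> x\<^sub>0 - composite f \<psi> x\<^sub>s)
          / (6 ^ 3 * (max (4 * M\<^sub>0) (8 * L\<^sub>f) * R\<^sub>0 ^ 4))"
    using gap[of 0] by (simp add: start u_def K_def H_def)
  ultimately have phase1: "m = 0 \<or> real m \<le> 1 + 1 / log 2 (4/3) *
        log 2 (log 2 (real_of_ereal (composite f \<psi> x\<^sub>0 - composite f \<psi> x\<^sub>s)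
          / (6 ^ 3 * (max (4 * M\<^sub>0) (8 * L\<^sub>f) * R\<^sub>0 ^ 4))))"
    by simp
  have rate: "\<delta> k * (real k - real m) ^ 3 \<le> 42 ^ 3 * H * R\<^sub>0 ^ 4" if "m \<le> k" "k \<le> T" for k
  proof -
    have "u k * (real k - real m) ^ 3 \<le> 7 ^ 3"
    proof (rule cubic_rate_phase[where T = T])
      show "0 \<le> u t" if "t \<le> T" for t using \<delta>0[of t] K that by (simp add: u_def)
    qed (use rec um that in auto)
    then have "K * (u k * (real k - real m) ^ 3) \<le> K * 7 ^ 3"
      using K by (intro mult_left_mono) auto
    moreover have "\<delta> k = K * u k" using K by (simp add: u_def)
    ultimately show ?thesis by (simp add: K_def mult_ac)
  qed
  have phase2: "composite f \<psi> (x k) - composite f \<psi> x\<^sub>s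
        \<le> ereal (42 ^ 3 * max (4 * M\<^sub>0) (8 * L\<^sub>f) * R\<^sub>0 ^ 4) / ereal ((real k - real m) ^ 3)"
    if k: "m \<le> k" "k \<le> T" for k
  proof (cases "k = m")
    \<comment> \<open>The denominator is 0 here, and a positive \<open>ereal\<close> divided by 0 is
      infinity.\<close>
    case True
    then show ?thesis using H R_pos by (simp add: H_def[symmetric] divide_ereal_def)
  next
    case False
    then have "(real k - real m) ^ 3 > 0" using k by simp
    then show ?thesis using rate[OF k] k
      by (simp add: gap H_def[symmetric] pos_le_divide_eq)
  qed
  obtain s where s: "T = Suc s" using mT by (cases T) auto
  \<comment> \<open>The gap at \<open>x T\<close> is bounded below through the accepted trial of
    iteration \<open>T - 1\<close>, which produced this point.\<close>
  have "it s \<in> {first_trial M\<^sub>0 (M s)..it s}" using iteration(1)[of s] s by simp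
  then have "ereal \<epsilon> \<le> min (ereal (norm (Gp s (it s)))) (composite f \<psi> (xp s (it s)) - composite f \<psi> x\<^sub>s)"
    using gap_ge[rule_format, of s "it s"] s by simp
  moreover have "xp s (it s) = x T" using iteration(5)[of s] s by simp
  ultimately have "\<epsilon> \<le> \<delta> T" using gap[of T] by simp
  then have "\<epsilon> * (real T - real m) ^ 3 \<le> \<delta> T * (real T - real m) ^ 3"
    using mT by (intro mult_right_mono) auto
  also have "\<dots> \<le> 42 ^ 3 * H * R\<^sub>0 ^ 4" using rate[of T] mT by simp
  finally have "(real T - real m) ^ 3 \<le> 42 ^ 3 * H * R\<^sub>0 ^ 4 / \<epsilon>"
    using eps_pos by (simp add: field_simps)
  moreover have "(42 * H powr (1/3) * R\<^sub>0 powr (4/3) * \<epsilon> powr (-1/3)) ^ 3 = 42 ^ 3 * H * R\<^sub>0 ^ 4 / \<epsilon>"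
  proof -
    have "(H powr (1/3)) ^ 3 = H" using H by (subst powr_power) auto
    moreover have "(R\<^sub>0 powr (4/3)) ^ 3 = R\<^sub>0 ^ 4" using R_pos by (subst powr_power) auto
    moreover have "(\<epsilon> powr (-1/3)) ^ 3 = 1 / \<epsilon>"
      using eps_pos by (subst powr_power) (auto simp: powr_minus_divide)
    ultimately show ?thesis by (simp only: power_mult_distrib) simp
  qed
  ultimately have "(real T - real m) ^ 3 \<le> (42 * H powr (1/3) * R\<^sub>0 powr (4/3) * \<epsilon> powr (-1/3)) ^ 3"
    by simp
  then have "real T - real m \<le> 42 * H powr (1/3) * R\<^sub>0 powr (4/3) * \<epsilon> powr (-1/3)"
    using mT by (subst (asm) power_mono_iff) auto
  then have phase3: "real T \<le> real m + 42 * max (4 * M\<^sub>0) (8 * L\<^sub>f) powr (1/3) * R\<^sub>0 powr (4/3) * \<epsilon> powr (-1/3)"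
    by (simp add: H_def)
  show ?thesis using phase1 phase2 phase3 by blast
qed

end
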